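(* Let $\mathcal{V}$ be a semi-abelian variety of algebras. For any two objects $K$ and $Q$ of $\mathcal{V}$, the conglomerate $2\text{-}\mathrm{Ext}(Q,K)$ of all double extensions under $K$ and over $Q$ is small, i.e., it admits a bijection to a set.
   Context: Foundations: one works in ZFC with a fixed Grothendieck universe $\mathcal{U}$ (containing $\mathbb{N}$). The objects satisfying the ZFC axioms (including the Axiom of Choice) are called conglomerates; the elements of $\mathcal{U}$ are called sets, and the subconglomerates of $\mathcal{U}$ are called classes. A conglomerate is small when it admits a bijection to a set (an element of $\mathcal{U}$). Categories have classes of objects and arrows. The algebras of a variety have sets as underlying sets, and the signature of a variety is a set of finitary operations. A category is semi-abelian when it is pointed, Barr exact, Bourn protomodular and has finite coproducts. A semi-abelian variety is a variety of algebras (in the sense of universal algebra) which is semi-abelian as a category. By a theorem of Bourn and Janelidze, a variety is semi-abelian if and only if its free algebra on the empty set is a singleton (so there is a unique constant $0$) and there exist an integer $\ell\geq 1$, binary operations $\alpha_1,\dots,\alpha_\ell$ satisfying $\alpha_i(x,x)=0$ for all $i$, and an $(\ell+1)$-ary operation $\beta$ satisfying $\beta(\alpha_1(x,y),\dots,\alpha_\ell(x,y),y)=x$. A short exact sequence $0\to A\xrightarrow{k} B\xrightarrow{q} C\to 0$ is a pair $(k,q)$ with $k$ a kernel of $q$ and $q$ a cokernel of $k$. A $(3\times 3)$-diagram from $K$ to $Q$ is a commutative diagram $$\begin{array}{ccccc} K & \to & X_2' & \to & I_2'\\ \downarrow & & \downarrow & & \downarrow\\ X_2 & \to & Y & \to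 & X_1'\\ \downarrow & & \downarrow & & \downarrow\\ I_2 & \to & X_1 & \to & Q\end{array}$$ in which all three rows and all three columns are short exact sequences. A morphism of such diagrams is a natural transformation. Two $(3\times 3)$-diagrams from $K$ to $Q$ are equivalent when they are joined by a finite zigzag of morphisms whose components at $K$ and at $Q$ are the identities $1_K$ and $1_Q$. The equivalence classes are called double extensions under $K$ and over $Q$, and form the conglomerate $2\text{-}\mathrm{Ext}(Q,K)$. *)

theory Defs
  imports "HOL-Library.FuncSet"
begin

section \<open>The universe\<close>

text \<open>
  The type \<open>'u\<close> plays the role of the fixed Grothendieck universe: its inhabitants are the sets, and
  \<open>elts x\<close> is the collection of all members of the set \<open>x\<close>.  Since the members of a set
  are again of type \<open>'u\<close>, transitivity of the universe is built in.  Classes are rendered by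
  HOL sets over \<open>'u\<close>, conglomerates by HOL sets over arbitrary types.  The first two conditions
  are the axioms of extensionality and foundation of the ambient ZFC; then come the closure
  conditions: unordered pairs, full power sets, and unions of families indexed by a set; the last
  condition says that the set of von Neumann natural numbers belongs to the universe.
\<close>

locale grothendieck_universe =
  fixes elts :: "'u \<Rightarrow> 'u set"
  assumes extensionality: "elts x = elts y \<Longrightarrow> x = y"
    and foundation: "wf {(x, y). x \<in> elts y}"
    and pairing: "\<exists>z. elts z = {x, y}"
    and power_set: "\<exists>z. elts ` elts z = Pow (elts x)"
    and family_union: "\<exists>z. elts z = (\<Union>i\<in>elts x. elts (F i))"
    and naturals: "\<exists>z (n :: nat \<Rightarrow> 'u). elts (n 0) = {} \<and>
          (\<forall>i. elts (n (Suc i)) = insert (n i) (elts (n i))) \<and> elts z = range n"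

definition small :: "('u \<Rightarrow> 'u set) \<Rightarrow> 'a set \<Rightarrow> bool" where
  "small elts A \<longleftrightarrow> (\<exists>(x :: 'u) f. bij_betw f A (elts x))"


section \<open>Categories\<close>

record ('o, 'a) cat =
  Obj :: "'o set"
  Arr :: "'a set"
  Dom :: "'a \<Rightarrow> 'o"
  Cod :: "'a \<Rightarrow> 'o"
  Ident :: "'o \<Rightarrow> 'a"
  Comp :: "'a \<Rightarrow> 'a \<Rightarrow> 'a"  (infixr "\<cdot>\<index>" 70)

definition hom :: "('o, 'a) cat \<Rightarrow> 'o \<Rightarrow> 'o \<Rightarrow> 'a set" where
  "hom C A B = {f \<in> Arr C. Dom C f = A \<and> Cod C f = B}"

definition category :: "('o, 'a) cat \<Rightarrow> bool" where
  "category C \<longleftrightarrow>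
     (\<forall>f\<in>Arr C. Dom C f \<in> Obj C \<and> Cod C f \<in> Obj C) \<and>
     (\<forall>A\<in>Obj C. Ident C A \<in> hom C A A) \<and>
     (\<forall>f\<in>Arr C. \<forall>g\<in>Arr C. Cod C f = Dom C g \<longrightarrow> g \<cdot>\<^bsub>C\<^esub> f \<in> hom C (Dom C f) (Cod C g)) \<and>
     (\<forall>f\<in>Arr C. f \<cdot>\<^bsub>C\<^esub> Ident C (Dom C f) = f \<and> Ident C (Cod C f) \<cdot>\<^bsub>C\<^esub> f = f) \<and>
     (\<forall>f\<in>Arr C. \<forall>g\<in>Arr C. \<forall>h\<in>Arr C. Cod C f = Dom C g \<and> Cod C g = Dom C h \<longrightarrow>
        h \<cdot>\<^bsub>C\<^esub> (g \<cdot>\<^bsub>C\<^esub> f) = (h \<cdot>\<^bsub>C\<^esub> g) \<cdot>\<^bsub>C\<^esub> f)"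

definition iso :: "('o, 'a) cat \<Rightarrow> 'a \<Rightarrow> bool" where
  "iso C f \<longleftrightarrow> f \<in> Arr C \<and>
     (\<exists>g \<in> hom C (Cod C f) (Dom C f).
        g \<cdot>\<^bsub>C\<^esub> f = Ident C (Dom C f) \<and> f \<cdot>\<^bsub>C\<^esub> g = Ident C (Cod C f))"


subsection \<open>Limits and colimits\<close>

definition terminal :: "('o, 'a) cat \<Rightarrow> 'o \<Rightarrow> bool" where
  "terminal C T \<longleftrightarrow> T \<in> Obj C \<and> (\<forall>A\<in>Obj C. \<exists>!f. f \<in> hom C A T)"

definition initial :: "('o, 'a) cat \<Rightarrow> 'o \<Rightarrow> bool" where
  "initial C I \<longleftrightarrow> I \<in> Obj C \<and> (\<forall>A\<in>Obj C. \<exists>!f. f \<in> hom C I A)"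

definition pullback :: "('o, 'a) cat \<Rightarrow> 'a \<Rightarrow> 'a \<Rightarrow> 'a \<Rightarrow> 'a \<Rightarrow> bool" where
  "pullback C f g p q \<longleftrightarrow>
     f \<in> Arr C \<and> g \<in> Arr C \<and> p \<in> Arr C \<and> q \<in> Arr C \<and>
     Cod C f = Cod C g \<and> Dom C p = Dom C q \<and> Cod C p = Dom C f \<and> Cod C q = Dom C g \<and>
     f \<cdot>\<^bsub>C\<^esub> p = g \<cdot>\<^bsub>C\<^esub> q \<and>
     (\<forall>T\<in>Obj C. \<forall>a \<in> hom C T (Dom C f). \<forall>b \<in> hom C T (Dom C g). f \<cdot>\<^bsub>C\<^esub> a = g \<cdot>\<^bsub>C\<^esub> b \<longrightarrow>
        (\<exists>!t. t \<in> hom C T (Dom C p) \<and> p \<cdot>\<^bsub>C\<^esub> t = a \<and> q \<cdot>\<^bsub>C\<^esub> t = b))"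

definition coequalizer :: "('o, 'a) cat \<Rightarrow> 'a \<Rightarrow> 'a \<Rightarrow> 'a \<Rightarrow> bool" where
  "coequalizer C f g q \<longleftrightarrow>
     f \<in> Arr C \<and> g \<in> Arr C \<and> q \<in> Arr C \<and>
     Dom C f = Dom C g \<and> Cod C f = Cod C g \<and> Dom C q = Cod C f \<and>
     q \<cdot>\<^bsub>C\<^esub> f = q \<cdot>\<^bsub>C\<^esub> g \<and>
     (\<forall>T\<in>Obj C. \<forall>a \<in> hom C (Cod C f) T. a \<cdot>\<^bsub>C\<^esub> f = a \<cdot>\<^bsub>C\<^esub> g \<longrightarrow>
        (\<exists>!t. t \<in> hom C (Cod C q) T \<and> t \<cdot>\<^bsub>C\<^esub> q = a))"

definition coproduct :: "('o, 'a) cat \<Rightarrow> 'a \<Rightarrow> 'a \<Rightarrow> bool" where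
  "coproduct C i j \<longleftrightarrow>
     i \<in> Arr C \<and> j \<in> Arr C \<and> Cod C i = Cod C j \<and>
     (\<forall>T\<in>Obj C. \<forall>a \<in> hom C (Dom C i) T. \<forall>b \<in> hom C (Dom C j) T.
        (\<exists>!t. t \<in> hom C (Cod C i) T \<and> t \<cdot>\<^bsub>C\<^esub> i = a \<and> t \<cdot>\<^bsub>C\<^esub> j = b))"

definition finitely_complete :: "('o, 'a) cat \<Rightarrow> bool" where
  "finitely_complete C \<longleftrightarrow>
     (\<exists>T. terminal C T) \<and>
     (\<forall>f\<in>Arr C. \<forall>g\<in>Arr C. Cod C f = Cod C g \<longrightarrow> (\<exists>p q. pullback C f g p q))"

definition has_finite_coproducts :: "('o, 'a) cat \<Rightarrow> bool" where
  "has_finite_coproducts C \<longleftrightarrow>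
     (\<exists>I. initial C I) \<and>
     (\<forall>A\<in>Obj C. \<forall>B\<in>Obj C. \<exists>i j. coproduct C i j \<and> Dom C i = A \<and> Dom C j = B)"


subsection \<open>Semi-abelian categories\<close>

definition zero_object :: "('o, 'a) cat \<Rightarrow> 'o \<Rightarrow> bool" where
  "zero_object C Z \<longleftrightarrow> initial C Z \<and> terminal C Z"

definition pointed :: "('o, 'a) cat \<Rightarrow> bool" where
  "pointed C \<longleftrightarrow> (\<exists>Z. zero_object C Z)"

definition regular_epi :: "('o, 'a) cat \<Rightarrow> 'a \<Rightarrow> bool" where
  "regular_epi C q \<longleftrightarrow> (\<exists>f g. coequalizer C f g q)"

text \<open>The kernel pair of \<open>f\<close> is the pullback of \<open>f\<close> along itself.\<close>

definition regular_category :: "('o, 'a) cat \<Rightarrow> bool" where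
  "regular_category C \<longleftrightarrow>
     finitely_complete C \<and>
     (\<forall>f p q. pullback C f f p q \<longrightarrow> (\<exists>e. coequalizer C p q e)) \<and>
     (\<forall>f g p q. pullback C f g p q \<and> regular_epi C f \<longrightarrow> regular_epi C q)"

definition jointly_monic :: "('o, 'a) cat \<Rightarrow> 'a \<Rightarrow> 'a \<Rightarrow> bool" where
  "jointly_monic C r s \<longleftrightarrow>
     (\<forall>T\<in>Obj C. \<forall>a \<in> hom C T (Dom C r). \<forall>b \<in> hom C T (Dom C r).
        r \<cdot>\<^bsub>C\<^esub> a = r \<cdot>\<^bsub>C\<^esub> b \<and> s \<cdot>\<^bsub>C\<^esub> a = s \<cdot>\<^bsub>C\<^esub> b \<longrightarrow> a = b)"

text \<open>Internal equivalence relations \<open>r, s : R \<rightarrow> X\<close>.\<close>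

definition equivalence_relation :: "('o, 'a) cat \<Rightarrow> 'a \<Rightarrow> 'a \<Rightarrow> bool" where
  "equivalence_relation C r s \<longleftrightarrow>
     r \<in> Arr C \<and> s \<in> Arr C \<and> Dom C r = Dom C s \<and> Cod C r = Cod C s \<and>
     jointly_monic C r s \<and>
     (\<exists>d \<in> hom C (Cod C r) (Dom C r). r \<cdot>\<^bsub>C\<^esub> d = Ident C (Cod C r) \<and> s \<cdot>\<^bsub>C\<^esub> d = Ident C (Cod C r)) \<and>
     (\<exists>c \<in> hom C (Dom C r) (Dom C r). r \<cdot>\<^bsub>C\<^esub> c = s \<and> s \<cdot>\<^bsub>C\<^esub> c = r) \<and>
     (\<forall>p q. pullback C s r p q \<longrightarrow>
        (\<exists>t \<in> hom C (Dom C p) (Dom C r). r \<cdot>\<^bsub>C\<^esub> t = r \<cdot>\<^bsub>C\<^esub> p \<and> s \<cdot>\<^bsub>C\<^esub> t = s \<cdot>\<^bsub>C\<^esub> q))"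

definition Barr_exact :: "('o, 'a) cat \<Rightarrow> bool" where
  "Barr_exact C \<longleftrightarrow>
     regular_category C \<and>
     (\<forall>r s. equivalence_relation C r s \<longrightarrow> (\<exists>f. pullback C f f r s))"

text \<open>
  A point over \<open>B\<close> is a split epimorphism \<open>p : A \<rightarrow> B\<close> with a chosen section \<open>s\<close>.
  Pulling back along \<open>v : E \<rightarrow> B\<close> gives a change-of-base functor from points over \<open>B\<close> to points
  over \<open>E\<close>; Bourn protomodularity says that all these functors reflect isomorphisms.  Below,
  \<open>g\<close> is the image under this functor of the morphism of points \<open>f\<close> from \<open>(p, s)\<close> to
  \<open>(p', s')\<close>; a morphism of points is invertible exactly when its underlying arrow is.
\<close>

definition point :: "('o, 'a) cat \<Rightarrow> 'a \<Rightarrow> 'a \<Rightarrow> bool" where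
  "point C p s \<longleftrightarrow>
     p \<in> Arr C \<and> s \<in> hom C (Cod C p) (Dom C p) \<and> p \<cdot>\<^bsub>C\<^esub> s = Ident C (Cod C p)"

definition point_morphism :: "('o, 'a) cat \<Rightarrow> 'a \<Rightarrow> 'a \<Rightarrow> 'a \<Rightarrow> 'a \<Rightarrow> 'a \<Rightarrow> bool" where
  "point_morphism C p s p' s' f \<longleftrightarrow>
     point C p s \<and> point C p' s' \<and> Cod C p = Cod C p' \<and>
     f \<in> hom C (Dom C p) (Dom C p') \<and> p' \<cdot>\<^bsub>C\<^esub> f = p \<and> f \<cdot>\<^bsub>C\<^esub> s = s'"

definition Bourn_protomodular :: "('o, 'a) cat \<Rightarrow> bool" where
  "Bourn_protomodular C \<longleftrightarrow>
     (\<forall>p s. \<forall>v\<in>Arr C. point C p s \<and> Cod C v = Cod C p \<longrightarrow> (\<exists>a e. pullback C p v a e)) \<and>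
     (\<forall>p s p' s' f v a e a' e' g.
        point_morphism C p s p' s' f \<and> pullback C p v a e \<and> pullback C p' v a' e' \<and>
        g \<in> hom C (Dom C a) (Dom C a') \<and> a' \<cdot>\<^bsub>C\<^esub> g = f \<cdot>\<^bsub>C\<^esub> a \<and> e' \<cdot>\<^bsub>C\<^esub> g = e \<and>
        iso C g \<longrightarrow> iso C f)"

definition semi_abelian :: "('o, 'a) cat \<Rightarrow> bool" where
  "semi_abelian C \<longleftrightarrow>
     category C \<and> pointed C \<and> Barr_exact C \<and> Bourn_protomodular C \<and> has_finite_coproducts C"


subsection \<open>Short exact sequences\<close>

definition zero_arrow :: "('o, 'a) cat \<Rightarrow> 'a \<Rightarrow> bool" where
  "zero_arrow C f \<longleftrightarrow> f \<in> Arr C \<and>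
     (\<exists>Z. zero_object C Z \<and> (\<exists>g \<in> hom C (Dom C f) Z. \<exists>h \<in> hom C Z (Cod C f). f = h \<cdot>\<^bsub>C\<^esub> g))"

definition kernel :: "('o, 'a) cat \<Rightarrow> 'a \<Rightarrow> 'a \<Rightarrow> bool" where
  "kernel C k f \<longleftrightarrow>
     k \<in> Arr C \<and> f \<in> Arr C \<and> Cod C k = Dom C f \<and> zero_arrow C (f \<cdot>\<^bsub>C\<^esub> k) \<and>
     (\<forall>g\<in>Arr C. Cod C g = Dom C f \<and> zero_arrow C (f \<cdot>\<^bsub>C\<^esub> g) \<longrightarrow>
        (\<exists>!h. h \<in> hom C (Dom C g) (Dom C k) \<and> k \<cdot>\<^bsub>C\<^esub> h = g))"

definition cokernel :: "('o, 'a) cat \<Rightarrow> 'a \<Rightarrow> 'a \<Rightarrow> bool" where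
  "cokernel C q f \<longleftrightarrow>
     q \<in> Arr C \<and> f \<in> Arr C \<and> Cod C f = Dom C q \<and> zero_arrow C (q \<cdot>\<^bsub>C\<^esub> f) \<and>
     (\<forall>g\<in>Arr C. Cod C f = Dom C g \<and> zero_arrow C (g \<cdot>\<^bsub>C\<^esub> f) \<longrightarrow>
        (\<exists>!h. h \<in> hom C (Cod C q) (Cod C g) \<and> h \<cdot>\<^bsub>C\<^esub> q = g))"

definition short_exact :: "('o, 'a) cat \<Rightarrow> 'a \<Rightarrow> 'a \<Rightarrow> bool" where
  "short_exact C k q \<longleftrightarrow> kernel C k q \<and> cokernel C q k"


section \<open>Double extensions\<close>

datatype three = One | Two | Three

text \<open>
  Nine objects \<open>node i j\<close> (row \<open>i\<close>, column \<open>j\<close>) with row \<open>i\<close> given by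
  \<open>row_k i : node i One \<rightarrow> node i Two\<close> and \<open>row_q i : node i Two \<rightarrow> node i Three\<close>, and column \<open>j\<close>
  by \<open>col_k j : node One j \<rightarrow> node Two j\<close> and \<open>col_q j : node Two j \<rightarrow> node Three j\<close>.
\<close>

record ('o, 'a) diagram =
  node :: "three \<Rightarrow> three \<Rightarrow> 'o"
  row_k :: "three \<Rightarrow> 'a"
  row_q :: "three \<Rightarrow> 'a"
  col_k :: "three \<Rightarrow> 'a"
  col_q :: "three \<Rightarrow> 'a"

definition three_by_three :: "('o, 'a) cat \<Rightarrow> 'o \<Rightarrow> 'o \<Rightarrow> ('o, 'a) diagram set" where
  "three_by_three C K Q = {D.
     (\<forall>i j. node D i j \<in> Obj C) \<and>
     node D One One = K \<and> node D Three Three = Q \<and>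
     (\<forall>i. row_k D i \<in> hom C (node D i One) (node D i Two) \<and>
          row_q D i \<in> hom C (node D i Two) (node D i Three) \<and>
          short_exact C (row_k D i) (row_q D i)) \<and>
     (\<forall>j. col_k D j \<in> hom C (node D One j) (node D Two j) \<and>
          col_q D j \<in> hom C (node D Two j) (node D Three j) \<and>
          short_exact C (col_k D j) (col_q D j)) \<and>
     col_k D Two \<cdot>\<^bsub>C\<^esub> row_k D One = row_k D Two \<cdot>\<^bsub>C\<^esub> col_k D One \<and>
     col_k D Three \<cdot>\<^bsub>C\<^esub> row_q D One = row_q D Two \<cdot>\<^bsub>C\<^esub> col_k D Two \<and>
     col_q D Two \<cdot>\<^bsub>C\<^esub> row_k D Two = row_k D Three \<cdot>\<^bsub>C\<^esub> col_q D One \<and>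
     col_q D Three \<cdot>\<^bsub>C\<^esub> row_q D Two = row_q D Three \<cdot>\<^bsub>C\<^esub> col_q D Two}"

definition diagram_morphism ::
    "('o, 'a) cat \<Rightarrow> ('o, 'a) diagram \<Rightarrow> ('o, 'a) diagram \<Rightarrow> (three \<Rightarrow> three \<Rightarrow> 'a) \<Rightarrow> bool" where
  "diagram_morphism C D D' \<theta> \<longleftrightarrow>
     (\<forall>i j. \<theta> i j \<in> hom C (node D i j) (node D' i j)) \<and>
     (\<forall>i. \<theta> i Two \<cdot>\<^bsub>C\<^esub> row_k D i = row_k D' i \<cdot>\<^bsub>C\<^esub> \<theta> i One \<and>
          \<theta> i Three \<cdot>\<^bsub>C\<^esub> row_q D i = row_q D' i \<cdot>\<^bsub>C\<^esub> \<theta> i Two) \<and>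
     (\<forall>j. \<theta> Two j \<cdot>\<^bsub>C\<^esub> col_k D j = col_k D' j \<cdot>\<^bsub>C\<^esub> \<theta> One j \<and>
          \<theta> Three j \<cdot>\<^bsub>C\<^esub> col_q D j = col_q D' j \<cdot>\<^bsub>C\<^esub> \<theta> Two j)"

definition diagram_step ::
    "('o, 'a) cat \<Rightarrow> 'o \<Rightarrow> 'o \<Rightarrow> (('o, 'a) diagram \<times> ('o, 'a) diagram) set" where
  "diagram_step C K Q = {(D, D'). D \<in> three_by_three C K Q \<and> D' \<in> three_by_three C K Q \<and>
     (\<exists>\<theta>. diagram_morphism C D D' \<theta> \<and> \<theta> One One = Ident C K \<and> \<theta> Three Three = Ident C Q)}"

definition zigzag ::
    "('o, 'a) cat \<Rightarrow> 'o \<Rightarrow> 'o \<Rightarrow> (('o, 'a) diagram \<times> ('o, 'a) diagram) set" where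
  "zigzag C K Q = {(D, D'). D \<in> three_by_three C K Q \<and> D' \<in> three_by_three C K Q \<and>
     (D, D') \<in> (diagram_step C K Q \<union> (diagram_step C K Q)\<inverse>)\<^sup>*}"

definition two_Ext :: "('o, 'a) cat \<Rightarrow> 'o \<Rightarrow> 'o \<Rightarrow> ('o, 'a) diagram set set" where
  "two_Ext C Q K = three_by_three C K Q // zigzag C K Q"


section \<open>Varieties of algebras\<close>

text \<open>The variables of the identities are indexed by the natural numbers.\<close>

datatype 'u tm = Var nat | Op 'u "'u tm list"

record 'u presentation =
  symbols :: 'u
  arity :: "'u \<Rightarrow> nat"
  identities :: "('u tm \<times> 'u tm) set"

primrec well_formed :: "('u \<Rightarrow> 'u set) \<Rightarrow> 'u presentation \<Rightarrow> 'u tm \<Rightarrow> bool" where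
  "well_formed elts \<V> (Var n) \<longleftrightarrow> True"
| "well_formed elts \<V> (Op f ts) \<longleftrightarrow>
     f \<in> elts (symbols \<V>) \<and> length ts = arity \<V> f \<and> list_all (well_formed elts \<V>) ts"

definition variety_presentation :: "('u \<Rightarrow> 'u set) \<Rightarrow> 'u presentation \<Rightarrow> bool" where
  "variety_presentation elts \<V> \<longleftrightarrow>
     (\<forall>(s, t) \<in> identities \<V>. well_formed elts \<V> s \<and> well_formed elts \<V> t)"

record 'u algebra =
  carrier :: 'u
  oper :: "'u \<Rightarrow> 'u list \<Rightarrow> 'u"

primrec eval :: "'u algebra \<Rightarrow> (nat \<Rightarrow> 'u) \<Rightarrow> 'u tm \<Rightarrow> 'u" where
  "eval A \<rho> (Var n) = \<rho> n"
| "eval A \<rho> (Op f ts) = oper A f (map (eval A \<rho>) ts)"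

definition op_args :: "('u \<Rightarrow> 'u set) \<Rightarrow> 'u presentation \<Rightarrow> 'u algebra \<Rightarrow> ('u \<times> 'u list) set" where
  "op_args elts \<V> A =
     {(f, xs). f \<in> elts (symbols \<V>) \<and> length xs = arity \<V> f \<and> set xs \<subseteq> elts (carrier A)}"

text \<open>
  Operations are \<^const>\<open>undefined\<close> outside their intended domain, and likewise for the functions
  underlying homomorphisms, so that equality of algebras and of homomorphisms is the usual one.
\<close>

definition algebras :: "('u \<Rightarrow> 'u set) \<Rightarrow> 'u presentation \<Rightarrow> 'u algebra set" where
  "algebras elts \<V> = {A.
     (\<forall>(f, xs) \<in> op_args elts \<V> A. oper A f xs \<in> elts (carrier A)) \<and>
     (\<forall>f xs. (f, xs) \<notin> op_args elts \<V> A \<longrightarrow> oper A f xs = undefined) \<and>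
     (\<forall>(s, t) \<in> identities \<V>. \<forall>\<rho>. range \<rho> \<subseteq> elts (carrier A) \<longrightarrow> eval A \<rho> s = eval A \<rho> t)}"

record 'u homomorphism =
  source :: "'u algebra"
  target :: "'u algebra"
  func :: "'u \<Rightarrow> 'u"

definition homomorphisms :: "('u \<Rightarrow> 'u set) \<Rightarrow> 'u presentation \<Rightarrow> 'u homomorphism set" where
  "homomorphisms elts \<V> = {h.
     source h \<in> algebras elts \<V> \<and> target h \<in> algebras elts \<V> \<and>
     func h \<in> elts (carrier (source h)) \<rightarrow>\<^sub>E elts (carrier (target h)) \<and>
     (\<forall>(f, xs) \<in> op_args elts \<V> (source h).
        func h (oper (source h) f xs) = oper (target h) f (map (func h) xs))}"

definition variety ::
    "('u \<Rightarrow> 'u set) \<Rightarrow> 'u presentation \<Rightarrow> ('u algebra, 'u homomorphism) cat" where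
  "variety elts \<V> =
     \<lparr>Obj = algebras elts \<V>,
      Arr = homomorphisms elts \<V>,
      Dom = source,
      Cod = target,
      Ident = (\<lambda>A. \<lparr>source = A, target = A, func = (\<lambda>x\<in>elts (carrier A). x)\<rparr>),
      Comp = (\<lambda>h g. \<lparr>source = source g, target = target h,
                     func = compose (elts (carrier (source g))) (func h) (func g)\<rparr>)\<rparr>"

end

theory Submission
  imports Defs
begin

text \<open>
  Call \<open>Y\<close> the middle object of a three by three diagram from \<open>K\<close> to \<open>Q\<close>.  The other objects are
  \<open>K\<close>, \<open>Q\<close>, the kernels of the two quotient maps out of \<open>Y\<close>, these two quotients, and a quotient
  of each of the two kernels by \<open>K\<close>.  So the diagram is known once \<open>Y\<close> is known
  with its two kernels, the map \<open>K \<rightarrow> Y\<close> and the map \<open>Y \<rightarrow> Q\<close>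
  (\<open>diagram_step_from_middle\<close>).  Diagrams may be arbitrarily large, but a diagram can be replaced,
  within its equivalence class, by a subdiagram of bounded size, as in the downward
  Loewenheim-Skolem theorem.

  Exactness is first made a matter of elements (\<open>short_exact_iff\<close>): the first map is an injection
  onto the set of elements that the second sends to zero, and the second is onto.  What is not
  formal here is that a surjective homomorphism is the cokernel of its kernel, and this is where
  protomodularity enters (\<open>fibres_from_kernel\<close>).  Next, a subalgebra \<open>S\<close> of \<open>Y\<close> cuts out a
  subdiagram that is again three by three, with the same \<open>K\<close> and \<open>Q\<close>, if \<open>S\<close> contains the image
  of \<open>K\<close>, maps onto \<open>Q\<close>, and is closed under a choice of liftings of the elements over zero into
  the two kernels (\<open>restriction_three_by_three\<close>).

  Such an \<open>S\<close> is generated from the elements of \<open>K\<close> and chosen preimages of the elements of \<open>Q\<close> by the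
  operations of the variety and the lifting functions.  Its elements are named by formal terms in
  these symbols, and the terms form a small collection that is the same for all diagrams from \<open>K\<close> to \<open>Q\<close>
  (\<open>small_skolem_terms\<close>).  If the same equations between terms hold in two diagrams \<open>D\<close> and \<open>E\<close>,
  then sending the value of a term in \<open>D\<close> to its value in \<open>E\<close> is a well-defined homomorphism from
  \<open>S\<close>.  The terms are chosen so that their equations also tell which elements of \<open>S\<close> lie in either
  kernel and over which element of \<open>Q\<close> they lie.  So this homomorphism extends to a morphism to \<open>E\<close> from
  the subdiagram of \<open>D\<close> cut out by \<open>S\<close>; the case \<open>E = D\<close> is the inclusion, and
  \<open>D\<close> and \<open>E\<close> are equivalent (\<open>same_equations_zigzag\<close>).  Hence the double extensions embed
  into the collection of sets of equations, which is small.
\<close>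

section \<open>Small collections\<close>

context grothendieck_universe
begin

lemma inj_elts: "inj elts"
  by (rule injI) (rule extensionality)

lemma subset_is_set:
  assumes "S \<subseteq> elts x"
  shows "\<exists>y. elts y = S"
proof -
  obtain z where "elts ` elts z = Pow (elts x)"
    using power_set by blast
  with assms have "S \<in> elts ` elts z" by simp
  then show ?thesis by auto
qed

definition collect :: "'u set \<Rightarrow> 'u" where
  "collect S = inv elts S"

lemma collect_elts [simp]: "collect (elts x) = x"
  by (simp add: collect_def inj_elts)

lemma elts_collect: "elts x = S \<Longrightarrow> elts (collect S) = S"
  by (auto simp: collect_def f_inv_into_f)

lemma elts_collect_subset: "S \<subseteq> elts x \<Longrightarrow> elts (collect S) = S"
  using subset_is_set elts_collect by blast

lemma elts_collect_doubleton [simp]: "elts (collect {x, y}) = {x, y}"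
  using pairing elts_collect by blast

lemma elts_collect_singleton [simp]: "elts (collect {x}) = {x}"
  using elts_collect_doubleton[of x x] by simp

text \<open>
  Kuratowski pairs.
\<close>

definition kpair :: "'u \<Rightarrow> 'u \<Rightarrow> 'u" where
  "kpair x y = collect {collect {x}, collect {x, y}}"

lemma collect_doubleton_eq: "collect {x, y} = collect {x', y'} \<longleftrightarrow> {x, y} = {x', y'}"
  by (metis elts_collect_doubleton)

lemma kpair_eq [simp]: "kpair x y = kpair x' y' \<longleftrightarrow> x = x' \<and> y = y'"
proof
  assume "kpair x y = kpair x' y'"
  then have "{collect {x, x}, collect {x, y}} = {collect {x', x'}, collect {x', y'}}"
    unfolding kpair_def collect_doubleton_eq by simp
  then show "x = x' \<and> y = y'"
    unfolding doubleton_eq_iff collect_doubleton_eq by auto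
qed auto

lemma smallI_elts: "small elts (elts x)"
  unfolding small_def using bij_betw_id by blast

lemma small_inj:
  assumes "small elts B" "inj_on f A" "f ` A \<subseteq> B"
  shows "small elts A"
proof -
  obtain x g where g: "bij_betw g B (elts x)"
    using assms(1) unfolding small_def by blast
  have inj: "inj_on (g \<circ> f) A"
    using assms g by (meson bij_betw_def comp_inj_on inj_on_subset)
  have "(g \<circ> f) ` A \<subseteq> elts x"
    using assms(3) g by (auto simp: bij_betw_def)
  then obtain y where "elts y = (g \<circ> f) ` A"
    using subset_is_set by blast
  with inj have "bij_betw (g \<circ> f) A (elts y)"
    by (simp add: bij_betw_def)
  then show ?thesis unfolding small_def by blast
qed

lemma small_subset: "small elts B \<Longrightarrow> A \<subseteq> B \<Longrightarrow> small elts A"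
  by (rule small_inj[of B id]) auto

lemma small_image:
  assumes "small elts A"
  shows "small elts (f ` A)"
  by (rule small_inj[OF assms inj_on_inv_into[OF order_refl]]) (auto intro: inv_into_into)

text \<open>
  Replacement: it is the instance of \<open>family_union\<close> for a family of singletons.
\<close>

lemma small_is_set:
  assumes "small elts (S :: 'u set)"
  shows "\<exists>y. elts y = S"
proof -
  obtain z g where g: "bij_betw g S (elts z)"
    using assms unfolding small_def by blast
  define k where "k = inv_into S g"
  have "k ` elts z = S"
    unfolding k_def using bij_betw_inv_into[OF g] by (simp add: bij_betw_def)
  moreover have "k ` elts z = (\<Union>w\<in>elts z. elts (collect {k w}))" by auto
  ultimately show ?thesis
    using family_union[where x = z] by metis
qed

text \<open>
  Encode the elements by Kuratowski pairs.  The pairs over a fixed first component form a set, and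
  so does the union of these sets as that component varies.
\<close>

lemma small_Sigma:
  assumes "small elts A" "\<And>a. a \<in> A \<Longrightarrow> small elts (B a)"
  shows "small elts (Sigma A B)"
proof -
  obtain x f where f: "bij_betw f A (elts x)"
    using assms(1) unfolding small_def by blast
  obtain y g where g: "\<And>a. a \<in> A \<Longrightarrow> bij_betw (g a) (B a) (elts (y a))"
    using assms(2) unfolding small_def by metis
  let ?h = "\<lambda>(a, b). kpair (f a) (g a b)"
  have row: "\<exists>z. elts z = kpair u ` elts v" for u v
  proof -
    have "kpair u ` elts v = (\<Union>w\<in>elts v. elts (collect {kpair u w}))" by auto
    then show ?thesis using family_union[where x = v] by metis
  qed
  define r where "r u = (let a = inv_into A f u in SOME z. elts z = kpair u ` elts (y a))" for u
  have r: "elts (r u) = kpair u ` elts (y (inv_into A f u))" for u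
    unfolding r_def Let_def using row by (rule someI_ex)
  obtain z where z: "elts z = (\<Union>u\<in>elts x. elts (r u))"
    using family_union by blast
  have "inj_on ?h (Sigma A B)"
    using f g by (auto simp: inj_on_def bij_betw_def)
  moreover have "?h ` Sigma A B \<subseteq> elts z"
  proof clarify
    fix a b assume a: "a \<in> A" and b: "b \<in> B a"
    have "f a \<in> elts x" using f a by (auto simp: bij_betw_def)
    moreover have "inv_into A f (f a) = a" using f a by (auto simp: bij_betw_def)
    moreover have "g a b \<in> elts (y a)" using g[OF a] b by (auto simp: bij_betw_def)
    ultimately show "kpair (f a) (g a b) \<in> elts z"
      unfolding z r by force
  qed
  ultimately show ?thesis
    using small_inj smallI_elts by metis
qed

lemma small_UNION:
  assumes "small elts A" "\<And>a. a \<in> A \<Longrightarrow> small elts (B a)"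
  shows "small elts (\<Union>a\<in>A. B a)"
proof -
  have "(\<Union>a\<in>A. B a) = snd ` Sigma A B" by force
  then show ?thesis by (simp only: small_image[OF small_Sigma[OF assms]])
qed

lemma small_Times: "small elts A \<Longrightarrow> small elts B \<Longrightarrow> small elts (A \<times> B)"
  by (rule small_Sigma)

lemma small_Pow:
  assumes "small elts A"
  shows "small elts (Pow A)"
proof -
  obtain x f where f: "bij_betw f A (elts x)"
    using assms unfolding small_def by blast
  obtain z where z: "elts ` elts z = Pow (elts x)"
    using power_set by blast
  have "small elts (Pow (elts x))"
    using small_image[OF smallI_elts, of elts z] z by simp
  moreover have "inj_on (image f) (Pow A)"
    using f by (auto simp: bij_betw_def inj_on_image_Pow)
  moreover have "image f ` Pow A \<subseteq> Pow (elts x)"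
    using f by (auto simp: bij_betw_def)
  ultimately show ?thesis by (rule small_inj)
qed

text \<open>Foundation makes the von Neumann numerals pairwise different.\<close>

lemma small_nat: "small elts (UNIV :: nat set)"
proof -
  obtain z and n :: "nat \<Rightarrow> 'u" where suc: "\<And>i. elts (n (Suc i)) = insert (n i) (elts (n i))"
      and z: "elts z = range n"
    using naturals by blast
  have mem: "n i \<in> elts (n j)" if "i < j" for i j
    using that by (induction j) (auto simp: suc less_Suc_eq)
  have "x \<notin> elts x" for x
    using foundation by (auto dest: wf_not_refl)
  then have "inj n"
    by (metis mem linorder_injI)
  then show ?thesis
    using small_inj[OF smallI_elts, of n UNIV z] z by auto
qed

lemma small_Un:
  assumes "small elts A" "small elts B"
  shows "small elts (A \<union> B)"
proof -
  have "small elts (\<Union>i\<in>(UNIV :: nat set). if i = 0 then A else B)"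
    by (rule small_UNION[OF small_nat]) (simp add: assms)
  moreover have "A \<union> B \<subseteq> (\<Union>i\<in>(UNIV :: nat set). if i = 0 then A else B)"
    by (rule subsetI) (rule_tac a = "if x \<in> A then 0 else 1" in UN_I, auto)
  ultimately show ?thesis
    by (rule small_subset)
qed

lemma small_lists_length:
  assumes "small elts A"
  shows "small elts {xs. set xs \<subseteq> A \<and> length xs = n}"
proof (induction n)
  case 0
  have "{xs. set xs \<subseteq> A \<and> length xs = 0} = (\<lambda>_. []) ` (UNIV :: nat set)" by auto
  then show ?case using small_image[OF small_nat, of "\<lambda>_. []"] by simp
next
  case (Suc n)
  have "{xs. set xs \<subseteq> A \<and> length xs = Suc n} \<subseteq>
      (\<lambda>p. fst p # snd p) ` (A \<times> {xs. set xs \<subseteq> A \<and> length xs = n})"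
  proof
    fix xs assume "xs \<in> {xs. set xs \<subseteq> A \<and> length xs = Suc n}"
    then obtain y ys where "xs = y # ys" "y \<in> A" "set ys \<subseteq> A" "length ys = n"
      by (cases xs) auto
    then show "xs \<in> (\<lambda>p. fst p # snd p) ` (A \<times> {xs. set xs \<subseteq> A \<and> length xs = n})"
      by (intro image_eqI[of _ _ "(y, ys)"]) auto
  qed
  then show ?case by (rule small_subset[OF small_image[OF small_Times[OF assms Suc]]])
qed

end


section \<open>Algebras and homomorphisms\<close>

locale variety_of_algebras = grothendieck_universe elts for elts :: "'u \<Rightarrow> 'u set" +
  fixes \<V> :: "'u presentation"
  assumes presentation: "variety_presentation elts \<V>"
begin

abbreviation \<C> where "\<C> \<equiv> variety elts \<V>"

abbreviation Alg where "Alg \<equiv> algebras elts \<V>"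

abbreviation U :: "'u algebra \<Rightarrow> 'u set" where "U A \<equiv> elts (carrier A)"

abbreviation args :: "'u set \<Rightarrow> ('u \<times> 'u list) set" where
  "args S \<equiv> {(f, xs). f \<in> elts (symbols \<V>) \<and> length xs = arity \<V> f \<and> set xs \<subseteq> S}"

text \<open>
  Homomorphisms as plain functions, whose values outside the carrier do not matter; \<open>arrow\<close> below
  turns them into arrows of the category.
\<close>

definition morph :: "'u algebra \<Rightarrow> 'u algebra \<Rightarrow> ('u \<Rightarrow> 'u) \<Rightarrow> bool" where
  "morph A B h \<longleftrightarrow> A \<in> Alg \<and> B \<in> Alg \<and> h ` U A \<subseteq> U B \<and>
     (\<forall>(f, xs)\<in>args (U A). h (oper A f xs) = oper B f (map h xs))"

lemma Alg_oper: "A \<in> Alg \<Longrightarrow> (f, xs) \<in> args (U A) \<Longrightarrow> oper A f xs \<in> U A"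
  by (auto simp: algebras_def op_args_def)

lemma Alg_oper_undefined: "A \<in> Alg \<Longrightarrow> (f, xs) \<notin> args (U A) \<Longrightarrow> oper A f xs = undefined"
  by (auto simp: algebras_def op_args_def)

lemma Alg_identity:
  "A \<in> Alg \<Longrightarrow> (s, t) \<in> identities \<V> \<Longrightarrow> range \<rho> \<subseteq> U A \<Longrightarrow> eval A \<rho> s = eval A \<rho> t"
  by (auto simp: algebras_def)

lemma identity_well_formed:
  "(s, t) \<in> identities \<V> \<Longrightarrow> well_formed elts \<V> s \<and> well_formed elts \<V> t"
  using presentation by (auto simp: variety_presentation_def)

lemma morphI:
  assumes "A \<in> Alg" "B \<in> Alg" "\<And>x. x \<in> U A \<Longrightarrow> h x \<in> U B"
    and "\<And>f xs. (f, xs) \<in> args (U A) \<Longrightarrow> h (oper A f xs) = oper B f (map h xs)"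
  shows "morph A B h"
  using assms by (auto simp: morph_def)

lemma morph_Alg: "morph A B h \<Longrightarrow> A \<in> Alg \<and> B \<in> Alg"
  by (simp add: morph_def)

lemma morph_in: "morph A B h \<Longrightarrow> x \<in> U A \<Longrightarrow> h x \<in> U B"
  by (auto simp: morph_def)

lemma morph_oper:
  "morph A B h \<Longrightarrow> (f, xs) \<in> args (U A) \<Longrightarrow> h (oper A f xs) = oper B f (map h xs)"
  unfolding morph_def by blast

lemma args_map: "(f, xs) \<in> args S \<Longrightarrow> h ` S \<subseteq> T \<Longrightarrow> (f, map h xs) \<in> args T"
  by auto

lemma morph_args: "morph A B h \<Longrightarrow> (f, xs) \<in> args (U A) \<Longrightarrow> (f, map h xs) \<in> args (U B)"
  using args_map[of f xs "U A" h "U B"] by (simp add: morph_def)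

lemma morph_id: "A \<in> Alg \<Longrightarrow> morph A A (\<lambda>x. x)"
  by (rule morphI) auto

lemma morph_comp:
  assumes "morph A B g" "morph B D h"
  shows "morph A D (\<lambda>x. h (g x))"
proof (rule morphI)
  show "A \<in> Alg" "D \<in> Alg" using assms by (simp_all add: morph_def)
  show "h (g x) \<in> U D" if "x \<in> U A" for x using that assms morph_in by blast
  fix f xs assume a: "(f, xs) \<in> args (U A)"
  have "h (g (oper A f xs)) = h (oper B f (map g xs))"
    by (simp only: morph_oper[OF assms(1) a])
  also have "\<dots> = oper D f (map h (map g xs))"
    by (rule morph_oper[OF assms(2) morph_args[OF assms(1) a]])
  finally show "h (g (oper A f xs)) = oper D f (map (\<lambda>x. h (g x)) xs)"
    by (simp add: comp_def)
qed

lemma morph_cong: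
  assumes "morph A B g" "\<And>x. x \<in> U A \<Longrightarrow> h x = g x"
  shows "morph A B h"
proof (rule morphI)
  show "A \<in> Alg" "B \<in> Alg" using assms by (simp_all add: morph_def)
  show "h x \<in> U B" if "x \<in> U A" for x using that assms morph_in by force
  fix f xs assume a: "(f, xs) \<in> args (U A)"
  have "map h xs = map g xs" using a assms(2) by auto
  moreover have "h (oper A f xs) = g (oper A f xs)"
    using Alg_oper[OF _ a] morph_Alg[OF assms(1)] by (intro assms(2)) simp
  ultimately show "h (oper A f xs) = oper B f (map h xs)"
    by (simp only: morph_oper[OF assms(1) a])
qed

text \<open>
  The set \<open>S\<close> is arbitrary so that the lemma also serves structures not yet known to satisfy the
  identities.
\<close>

lemma eval_in:
  assumes "\<And>f xs. (f, xs) \<in> args S \<Longrightarrow> oper A f xs \<in> S" "range \<rho> \<subseteq> S"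
  shows "well_formed elts \<V> t \<Longrightarrow> eval A \<rho> t \<in> S"
proof (induction t)
  case (Op f ts)
  then have "eval A \<rho> u \<in> S" if "u \<in> set ts" for u
    using that by (auto simp: list_all_iff)
  then have "(f, map (eval A \<rho>) ts) \<in> args S" using Op.prems by auto
  then show ?case using assms(1) by simp
qed (use assms(2) in auto)

lemma eval_hom:
  assumes "\<And>f xs. (f, xs) \<in> args S \<Longrightarrow> oper A f xs \<in> S \<and> h (oper A f xs) = oper B f (map h xs)"
    and "range \<rho> \<subseteq> S"
  shows "well_formed elts \<V> t \<Longrightarrow> h (eval A \<rho> t) = eval B (\<lambda>n. h (\<rho> n)) t"
proof (induction t)
  case (Op f ts)
  have "eval A \<rho> u \<in> S" if "u \<in> set ts" for u
    using that Op.prems by (intro eval_in) (auto simp: assms list_all_iff)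
  then have a: "(f, map (eval A \<rho>) ts) \<in> args S" using Op.prems by auto
  have "map h (map (eval A \<rho>) ts) = map (eval B (\<lambda>n. h (\<rho> n))) ts"
    using Op by (auto simp: list_all_iff)
  then show ?case using assms(1)[OF a] by (simp only: eval.simps)
qed auto

text \<open>
  An identity can be tested on its images under a jointly injective family of operation-preserving
  maps into algebras of the variety, so closure of the variety under subalgebras and under
  products needs no computation with terms.
\<close>

lemma AlgI:
  assumes closed: "\<And>f xs. (f, xs) \<in> args (U A) \<Longrightarrow> oper A f xs \<in> U A"
    and undef: "\<And>f xs. (f, xs) \<notin> args (U A) \<Longrightarrow> oper A f xs = undefined"
    and target: "\<And>i. i \<in> I \<Longrightarrow> B i \<in> Alg"
    and into: "\<And>i x. i \<in> I \<Longrightarrow> x \<in> U A \<Longrightarrow> h i x \<in> U (B i)"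
    and hom: "\<And>i f xs. i \<in> I \<Longrightarrow> (f, xs) \<in> args (U A) \<Longrightarrow>
        h i (oper A f xs) = oper (B i) f (map (h i) xs)"
    and joint: "\<And>x y. x \<in> U A \<Longrightarrow> y \<in> U A \<Longrightarrow> (\<And>i. i \<in> I \<Longrightarrow> h i x = h i y) \<Longrightarrow> x = y"
  shows "A \<in> Alg"
proof -
  have "eval A \<rho> s = eval A \<rho> t" if st: "(s, t) \<in> identities \<V>" and \<rho>: "range \<rho> \<subseteq> U A" for s t \<rho>
  proof (rule joint)
    have wf: "well_formed elts \<V> s" "well_formed elts \<V> t"
      using st identity_well_formed by auto
    show "eval A \<rho> s \<in> U A" "eval A \<rho> t \<in> U A"
      using eval_in[OF closed \<rho>] wf by auto
    fix i assume i: "i \<in> I"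
    have "h i (eval A \<rho> u) = eval (B i) (\<lambda>n. h i (\<rho> n)) u" if "well_formed elts \<V> u" for u
      by (rule eval_hom[OF _ \<rho> that]) (use closed hom[OF i] in blast)
    moreover have "range (\<lambda>n. h i (\<rho> n)) \<subseteq> U (B i)"
      using \<rho> into[OF i] by auto
    ultimately show "h i (eval A \<rho> s) = h i (eval A \<rho> t)"
      using Alg_identity[OF target[OF i] st] wf by simp
  qed
  then show ?thesis
    using closed undef unfolding algebras_def op_args_def by fastforce
qed


subsection \<open>Subalgebras\<close>

definition closed :: "'u algebra \<Rightarrow> 'u set \<Rightarrow> bool" where
  "closed A S \<longleftrightarrow> A \<in> Alg \<and> S \<subseteq> U A \<and> (\<forall>(f, xs)\<in>args S. oper A f xs \<in> S)"

definition sub :: "'u algebra \<Rightarrow> 'u set \<Rightarrow> 'u algebra" where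
  "sub A S = \<lparr>carrier = collect S,
     oper = (\<lambda>f xs. if (f, xs) \<in> args S then oper A f xs else undefined)\<rparr>"

lemma U_sub: "S \<subseteq> U A \<Longrightarrow> U (sub A S) = S"
  by (simp add: sub_def elts_collect_subset)

lemma U_sub_closed [simp]: "closed A S \<Longrightarrow> U (sub A S) = S"
  by (simp add: closed_def U_sub)

lemma oper_sub: "(f, xs) \<in> args S \<Longrightarrow> oper (sub A S) f xs = oper A f xs"
  by (simp add: sub_def)

lemma closed_oper: "closed A S \<Longrightarrow> (f, xs) \<in> args S \<Longrightarrow> oper A f xs \<in> S"
  unfolding closed_def by blast

lemma closedI:
  assumes "A \<in> Alg" "S \<subseteq> U A" "\<And>f xs. (f, xs) \<in> args S \<Longrightarrow> oper A f xs \<in> S"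
  shows "closed A S"
  using assms by (auto simp: closed_def)

lemma closed_subset: "closed A S \<Longrightarrow> S \<subseteq> U A"
  by (simp add: closed_def)

lemma args_mono: "(f, xs) \<in> args S \<Longrightarrow> S \<subseteq> T \<Longrightarrow> (f, xs) \<in> args T"
  by auto

lemma sub_Alg:
  assumes "closed A S"
  shows "sub A S \<in> Alg"
proof (rule AlgI[where I = "{()}" and B = "\<lambda>_. A" and h = "\<lambda>_ x. x"])
  have U: "U (sub A S) = S" by (rule U_sub_closed[OF assms])
  show "oper (sub A S) f xs \<in> U (sub A S)" if "(f, xs) \<in> args (U (sub A S))" for f xs
    using that oper_sub[of f xs S A] closed_oper[OF assms] unfolding U by simp
  show "oper (sub A S) f xs = undefined" if "(f, xs) \<notin> args (U (sub A S))" for f xs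
    using that unfolding U by (auto simp: sub_def)
  show "oper (sub A S) f xs = oper A f (map (\<lambda>x. x) xs)" if "(f, xs) \<in> args (U (sub A S))" for f xs
    using that oper_sub[of f xs S A] unfolding U by simp
  show "x \<in> U A" if "x \<in> U (sub A S)" for x
    using that closed_subset[OF assms] unfolding U by auto
qed (use assms in \<open>auto simp: closed_def\<close>)

lemma sub_full:
  assumes "A \<in> Alg"
  shows "sub A (U A) = A"
proof (rule algebra.equality)
  show "oper (sub A (U A)) = oper A"
    using Alg_oper_undefined[OF assms] by (intro ext) (auto simp: sub_def)
qed (simp_all add: sub_def)

lemma closed_full: "A \<in> Alg \<Longrightarrow> closed A (U A)"
  using Alg_oper by (intro closedI) auto

lemma morph_from_sub:
  assumes "closed A S" "morph A B h"
  shows "morph (sub A S) B h"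
proof (rule morphI)
  show "sub A S \<in> Alg" by (rule sub_Alg[OF assms(1)])
  show "B \<in> Alg" using assms(2) by (simp add: morph_def)
  show "h x \<in> U B" if "x \<in> U (sub A S)" for x
    using that assms(1) morph_in[OF assms(2)] closed_subset[OF assms(1)] by auto
  show "h (oper (sub A S) f xs) = oper B f (map h xs)" if "(f, xs) \<in> args (U (sub A S))" for f xs
  proof -
    have a: "(f, xs) \<in> args S" using that assms(1) by simp
    show ?thesis
      using morph_oper[OF assms(2) args_mono[OF a closed_subset[OF assms(1)]]] oper_sub[OF a] by simp
  qed
qed

lemma morph_into_sub:
  assumes "closed B S" "morph A B h" "\<And>x. x \<in> U A \<Longrightarrow> h x \<in> S"
  shows "morph A (sub B S) h"
proof (rule morphI)
  show "sub B S \<in> Alg" by (rule sub_Alg[OF assms(1)])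
  show "A \<in> Alg" using assms(2) by (simp add: morph_def)
  show "h x \<in> U (sub B S)" if "x \<in> U A" for x
    using that assms by simp
  fix f xs assume a: "(f, xs) \<in> args (U A)"
  then have "(f, map h xs) \<in> args S" using assms(3) by auto
  then show "h (oper A f xs) = oper (sub B S) f (map h xs)"
    by (simp only: oper_sub morph_oper[OF assms(2) a])
qed

lemma morph_restrict:
  assumes "closed A S" "closed B T" "morph A B h" "\<And>x. x \<in> S \<Longrightarrow> h x \<in> T"
  shows "morph (sub A S) (sub B T) h"
  using assms by (intro morph_into_sub morph_from_sub) auto

lemma morph_incl: "closed A S \<Longrightarrow> morph (sub A S) A (\<lambda>x. x)"
  by (rule morph_from_sub[OF _ morph_id]) (auto simp: closed_def)

lemma closed_image:
  assumes "closed A S" "morph A B h"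
  shows "closed B (h ` S)"
proof (rule closedI)
  show "B \<in> Alg" using assms(2) by (simp add: morph_def)
  show "h ` S \<subseteq> U B" using assms closed_subset morph_in by blast
  fix f ys assume a: "(f, ys) \<in> args (h ` S)"
  then have "ys \<in> map h ` lists S"
    by (auto simp: lists_image[symmetric])
  then obtain xs where xs: "ys = map h xs" "set xs \<subseteq> S" by auto
  then have b: "(f, xs) \<in> args S" using a by auto
  have "oper B f ys = h (oper A f xs)"
    using morph_oper[OF assms(2) args_mono[OF b closed_subset[OF assms(1)]]] xs by simp
  then show "oper B f ys \<in> h ` S" using closed_oper[OF assms(1) b] by simp
qed

lemma closed_vimage:
  assumes "closed B T" "morph A B h"
  shows "closed A {x \<in> U A. h x \<in> T}"
proof (rule closedI)
  show "A \<in> Alg" using assms(2) by (simp add: morph_def)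
  fix f xs assume a: "(f, xs) \<in> args {x \<in> U A. h x \<in> T}"
  then have b: "(f, xs) \<in> args (U A)" and c: "(f, map h xs) \<in> args T" by auto
  show "oper A f xs \<in> {x \<in> U A. h x \<in> T}"
    using Alg_oper[OF \<open>A \<in> Alg\<close> b] morph_oper[OF assms(2) b] closed_oper[OF assms(1) c] by simp
qed auto


subsection \<open>Algebras of pairs\<close>

definition proj1 :: "'u \<Rightarrow> 'u" where "proj1 p = (THE x. \<exists>y. p = kpair x y)"

definition proj2 :: "'u \<Rightarrow> 'u" where "proj2 p = (THE y. \<exists>x. p = kpair x y)"

lemma proj_kpair [simp]: "proj1 (kpair x y) = x" "proj2 (kpair x y) = y"
  by (auto simp: proj1_def proj2_def)

text \<open>
  A compatible relation on \<open>A\<close> is an algebra of pairs, with two projections to \<open>A\<close>.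
\<close>

definition pairs :: "('u \<Rightarrow> 'u \<Rightarrow> bool) \<Rightarrow> 'u algebra \<Rightarrow> 'u set" where
  "pairs P A = {kpair x y | x y. x \<in> U A \<and> y \<in> U A \<and> P x y}"

definition relalg :: "('u \<Rightarrow> 'u \<Rightarrow> bool) \<Rightarrow> 'u algebra \<Rightarrow> 'u algebra" where
  "relalg P A = \<lparr>carrier = collect (pairs P A),
     oper = (\<lambda>f ps. if (f, ps) \<in> args (pairs P A)
        then kpair (oper A f (map proj1 ps)) (oper A f (map proj2 ps)) else undefined)\<rparr>"

definition compatible :: "('u \<Rightarrow> 'u \<Rightarrow> bool) \<Rightarrow> 'u algebra \<Rightarrow> bool" where
  "compatible P A \<longleftrightarrow> A \<in> Alg \<and> (\<forall>f xs ys. (f, xs) \<in> args (U A) \<and> (f, ys) \<in> args (U A) \<and>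
     list_all2 P xs ys \<longrightarrow> P (oper A f xs) (oper A f ys))"

lemma U_relalg [simp]: "U (relalg P A) = pairs P A"
proof -
  have "small elts ((\<lambda>(x, y). kpair x y) ` (U A \<times> U A))"
    by (intro small_image small_Times smallI_elts)
  then have "small elts (pairs P A)"
    by (rule small_subset) (auto simp: pairs_def)
  then obtain y where "elts y = pairs P A" using small_is_set by blast
  then have "elts (collect (pairs P A)) = pairs P A" by (rule elts_collect)
  then show ?thesis by (simp add: relalg_def)
qed

lemma args_pairs:
  assumes "(f, ps) \<in> args (pairs P A)"
  shows "(f, map proj1 ps) \<in> args (U A)" "(f, map proj2 ps) \<in> args (U A)"
    "list_all2 P (map proj1 ps) (map proj2 ps)"
  using assms by (fastforce simp: pairs_def list_all2_conv_all_nth in_set_conv_nth)+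

lemma relalg_oper:
  "(f, ps) \<in> args (pairs P A) \<Longrightarrow>
    oper (relalg P A) f ps = kpair (oper A f (map proj1 ps)) (oper A f (map proj2 ps))"
  by (simp add: relalg_def)

lemma relalg_Alg:
  assumes "compatible P A"
  shows "relalg P A \<in> Alg"
proof (rule AlgI[where I = UNIV and B = "\<lambda>_. A" and h = "\<lambda>b. if b then proj1 else proj2"])
  have A: "A \<in> Alg" using assms by (simp add: compatible_def)
  show "A \<in> Alg" for i :: bool by (rule A)
  show "oper (relalg P A) f ps \<in> U (relalg P A)" if "(f, ps) \<in> args (U (relalg P A))" for f ps
  proof -
    have a: "(f, ps) \<in> args (pairs P A)" using that by simp
    have "P (oper A f (map proj1 ps)) (oper A f (map proj2 ps))"
      using assms args_pairs[OF a] unfolding compatible_def by blast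
    then show ?thesis
      using Alg_oper[OF A] args_pairs[OF a] relalg_oper[OF a] by (auto simp: pairs_def)
  qed
  show "oper (relalg P A) f xs = undefined" if "(f, xs) \<notin> args (U (relalg P A))" for f xs
    using that unfolding U_relalg by (auto simp: relalg_def)
  show "(if b then proj1 else proj2) x \<in> U A" if "x \<in> U (relalg P A)" for x b
    using that by (auto simp: pairs_def)
  show "(if b then proj1 else proj2) (oper (relalg P A) f ps) =
      oper A f (map (if b then proj1 else proj2) ps)"
    if "(f, ps) \<in> args (U (relalg P A))" for f ps b
    using that relalg_oper[of f ps P A] by simp
  show "x = y" if "x \<in> U (relalg P A)" "y \<in> U (relalg P A)"
    and "\<And>b. b \<in> UNIV \<Longrightarrow> (if b then proj1 else proj2) x = (if b then proj1 else proj2) y" for x y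
    using that(1,2) that(3)[of True] that(3)[of False] by (auto simp: pairs_def)
qed

lemma morph_proj:
  assumes "compatible P A"
  shows "morph (relalg P A) A proj1" "morph (relalg P A) A proj2"
proof -
  have A: "A \<in> Alg" using assms by (simp add: compatible_def)
  show "morph (relalg P A) A proj1" "morph (relalg P A) A proj2"
    by (rule morphI; use A relalg_Alg[OF assms] relalg_oper[of _ _ P A] in \<open>auto simp: pairs_def\<close>)+
qed

lemma morph_kpair:
  assumes "compatible P A" "morph X A g" "morph X A h" "\<And>x. x \<in> U X \<Longrightarrow> P (g x) (h x)"
  shows "morph X (relalg P A) (\<lambda>x. kpair (g x) (h x))"
proof (rule morphI)
  show "X \<in> Alg" using assms(2) by (simp add: morph_def)
  show "relalg P A \<in> Alg" by (rule relalg_Alg[OF assms(1)])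
  have into: "kpair (g x) (h x) \<in> pairs P A" if "x \<in> U X" for x
    using that assms(4) morph_in[OF assms(2)] morph_in[OF assms(3)] by (auto simp: pairs_def)
  then show "kpair (g x) (h x) \<in> U (relalg P A)" if "x \<in> U X" for x
    using that by simp
  fix f xs assume a: "(f, xs) \<in> args (U X)"
  then have b: "(f, map (\<lambda>x. kpair (g x) (h x)) xs) \<in> args (pairs P A)" using into by auto
  show "kpair (g (oper X f xs)) (h (oper X f xs)) =
      oper (relalg P A) f (map (\<lambda>x. kpair (g x) (h x)) xs)"
    by (simp add: relalg_oper[OF b] morph_oper[OF assms(2) a] morph_oper[OF assms(3) a] comp_def)
qed


subsection \<open>Arrows of the variety\<close>

definition arrow :: "'u algebra \<Rightarrow> 'u algebra \<Rightarrow> ('u \<Rightarrow> 'u) \<Rightarrow> 'u homomorphism" where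
  "arrow A B h = \<lparr>source = A, target = B, func = restrict h (U A)\<rparr>"

lemma variety_simps [simp]:
  "Obj \<C> = Alg" "Dom \<C> = source" "Cod \<C> = target"
  by (simp_all add: variety_def)

lemma func_Ident: "x \<in> U A \<Longrightarrow> func (Ident \<C> A) x = x"
  by (simp add: variety_def)

lemma func_comp: "x \<in> U (source g) \<Longrightarrow> func (h \<cdot>\<^bsub>\<C>\<^esub> g) x = func h (func g x)"
  by (simp add: variety_def compose_def)

lemma hom_iff:
  "f \<in> hom \<C> A B \<longleftrightarrow>
     source f = A \<and> target f = B \<and> morph A B (func f) \<and> func f \<in> extensional (U A)"
  unfolding hom_def variety_def homomorphisms_def morph_def op_args_def PiE_def
  by (auto simp: Pi_iff image_subset_iff)

lemma hom_morph: "f \<in> hom \<C> A B \<Longrightarrow> morph A B (func f)"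
  by (simp add: hom_iff)

lemma hom_source: "f \<in> hom \<C> A B \<Longrightarrow> source f = A"
  and hom_target: "f \<in> hom \<C> A B \<Longrightarrow> target f = B"
  by (simp_all add: hom_iff)

lemma hom_Arr: "f \<in> hom \<C> A B \<Longrightarrow> f \<in> Arr \<C>"
  by (simp add: hom_def)

lemma arrow_hom:
  assumes "morph A B h"
  shows "arrow A B h \<in> hom \<C> A B"
  unfolding hom_iff using morph_cong[OF assms, of "restrict h (U A)"]
  by (simp add: arrow_def)

lemma func_arrow [simp]: "x \<in> U A \<Longrightarrow> func (arrow A B h) x = h x"
  by (simp add: arrow_def)

lemma arrow_sel [simp]: "source (arrow A B h) = A" "target (arrow A B h) = B"
  by (simp_all add: arrow_def)

lemma hom_eqI:
  assumes "f \<in> hom \<C> A B" "g \<in> hom \<C> A B" "\<And>x. x \<in> U A \<Longrightarrow> func f x = func g x"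
  shows "f = g"
proof (rule homomorphism.equality)
  show "func f = func g"
    using assms by (intro extensionalityI[of _ "U A"]) (auto simp: hom_iff)
qed (use assms in \<open>auto simp: hom_iff\<close>)

lemma Ident_arrow: "Ident \<C> A = arrow A A (\<lambda>x. x)"
  by (simp add: variety_def arrow_def)

lemma comp_hom:
  assumes "g \<in> hom \<C> A B" "h \<in> hom \<C> B D"
  shows "h \<cdot>\<^bsub>\<C>\<^esub> g \<in> hom \<C> A D"
proof -
  have "h \<cdot>\<^bsub>\<C>\<^esub> g = arrow A D (\<lambda>x. func h (func g x))"
    using assms[unfolded hom_iff] by (simp add: variety_def arrow_def compose_def)
  then show ?thesis
    using arrow_hom[OF morph_comp[OF hom_morph hom_morph]] assms by metis
qed

lemma comp_eqI:
  assumes "g \<in> hom \<C> A B" "h \<in> hom \<C> B D" "g' \<in> hom \<C> A B'" "h' \<in> hom \<C> B' D"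
    and "\<And>x. x \<in> U A \<Longrightarrow> func h (func g x) = func h' (func g' x)"
  shows "h \<cdot>\<^bsub>\<C>\<^esub> g = h' \<cdot>\<^bsub>\<C>\<^esub> g'"
  by (rule hom_eqI[OF comp_hom[OF assms(1,2)] comp_hom[OF assms(3,4)]])
    (use assms in \<open>simp add: func_comp hom_source\<close>)

lemma comp_eqD:
  assumes "h \<cdot>\<^bsub>\<C>\<^esub> g = h' \<cdot>\<^bsub>\<C>\<^esub> g'" "g \<in> hom \<C> A B" "g' \<in> hom \<C> A B'" "x \<in> U A"
  shows "func h (func g x) = func h' (func g' x)"
  using func_comp[of x g h] func_comp[of x g' h'] assms by (simp add: hom_source)

end


section \<open>Short exact sequences in a semi-abelian variety\<close>

locale semi_abelian_variety = variety_of_algebras elts \<V>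
  for elts :: "'u \<Rightarrow> 'u set" and \<V> :: "'u presentation" +
  assumes semi_abelian: "semi_abelian \<C>"
begin

subsection \<open>The zero element\<close>

text \<open>
  The one-element algebra satisfies all identities; comparison with it shows that terminal objects,
  and hence zero objects, have exactly one element.
\<close>

lemma trivial_algebra: "\<exists>T\<in>Alg. \<exists>x. U T = {x}"
proof -
  obtain x :: 'u where True by simp
  define T where "T = \<lparr>carrier = collect {x},
    oper = (\<lambda>f xs. if (f, xs) \<in> args {x} then x else undefined)\<rparr>"
  have U: "U T = {x}" by (simp add: T_def)
  have "T \<in> Alg"
  proof (rule AlgI[where I = "{}" and B = "\<lambda>_ :: unit. T" and h = "\<lambda>_ x. x"])
    show "oper T f xs \<in> U T" if "(f, xs) \<in> args (U T)" for f xs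
      using that unfolding U by (simp add: T_def)
    show "oper T f xs = undefined" if "(f, xs) \<notin> args (U T)" for f xs
      using that unfolding U by (auto simp: T_def)
  qed (simp_all add: U)
  with U show ?thesis by blast
qed

lemma morph_to_trivial:
  assumes "A \<in> Alg" "T \<in> Alg" "U T = {x}"
  shows "morph A T (\<lambda>_. x)"
proof (rule morphI)
  fix f xs assume "(f, xs) \<in> args (U A)"
  then have "(f, map (\<lambda>_. x) xs) \<in> args (U T)" using assms(3) by auto
  then have "oper T f (map (\<lambda>_. x) xs) \<in> {x}" using Alg_oper[OF assms(2)] assms(3) by blast
  then show "x = oper T f (map (\<lambda>_. x) xs)" by simp
qed (use assms in auto)

lemma terminal_trivial:
  assumes "terminal \<C> Z"
  shows "\<exists>z. U Z = {z}"
proof -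
  have Z: "Z \<in> Alg" and ex: "\<And>A. A \<in> Alg \<Longrightarrow> \<exists>!f. f \<in> hom \<C> A Z"
    using assms by (auto simp: terminal_def)
  obtain T x where T: "T \<in> Alg" "U T = {x}" using trivial_algebra by blast
  obtain f where f: "f \<in> hom \<C> T Z" using ex[OF T(1)] by blast
  have "morph Z Z (\<lambda>_. func f x)"
    by (rule morph_comp[OF morph_to_trivial[OF Z T] hom_morph[OF f]])
  then have "arrow Z Z (\<lambda>_. func f x) = arrow Z Z (\<lambda>z. z)"
    using ex[OF Z] arrow_hom morph_id[OF Z] by blast
  then have "z = func f x" if "z \<in> U Z" for z
    using func_arrow[OF that] by metis
  moreover have "func f x \<in> U Z" using morph_in[OF hom_morph[OF f]] T by simp
  ultimately show ?thesis by blast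
qed

text \<open>
  The element \<open>zero A\<close> is the image of the only element of the zero object.  Since the zero object is
  initial, the choice of the homomorphism does not affect it, and homomorphisms preserve it.
\<close>

definition Zero :: "'u algebra" where "Zero = (SOME Z. zero_object \<C> Z)"

definition point0 :: 'u where "point0 = the_elem (U Zero)"

definition zero :: "'u algebra \<Rightarrow> 'u" where "zero A = (SOME g. morph Zero A g) point0"

lemma zero_object_Zero: "zero_object \<C> Zero"
  unfolding Zero_def using semi_abelian by (simp add: semi_abelian_def pointed_def some_eq_ex)

lemma Zero_Alg: "Zero \<in> Alg"
  using zero_object_Zero by (simp add: zero_object_def initial_def)

lemma U_Zero: "U Zero = {point0}"
proof -
  have "terminal \<C> Zero" using zero_object_Zero by (simp add: zero_object_def)
  then obtain z where z: "U Zero = {z}" using terminal_trivial by blast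
  then show ?thesis unfolding point0_def z by simp
qed

lemma zero_eq:
  assumes "morph Zero A g"
  shows "g point0 = zero A"
proof -
  have "A \<in> Alg" using assms by (simp add: morph_def)
  then have "\<exists>!f. f \<in> hom \<C> Zero A"
    using zero_object_Zero by (simp add: zero_object_def initial_def)
  moreover have "morph Zero A (SOME g. morph Zero A g)" using assms by (metis someI)
  ultimately have "arrow Zero A g = arrow Zero A (SOME g. morph Zero A g)"
    using arrow_hom assms by blast
  then show ?thesis
    using func_arrow[of point0 Zero A] U_Zero unfolding zero_def by (metis singletonI)
qed

lemma morph_from_Zero:
  assumes "A \<in> Alg"
  shows "\<exists>g. morph Zero A g \<and> g point0 = zero A"
proof -
  obtain f where "f \<in> hom \<C> Zero A"
    using zero_object_Zero assms by (auto simp: zero_object_def initial_def)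
  then show ?thesis using hom_morph zero_eq by blast
qed

lemma morph_to_Zero: "A \<in> Alg \<Longrightarrow> morph A Zero (\<lambda>_. point0)"
  by (rule morph_to_trivial[OF _ Zero_Alg U_Zero])

lemma morph_zero:
  assumes "morph A B h"
  shows "h (zero A) = zero B"
proof -
  obtain g where g: "morph Zero A g" "g point0 = zero A"
    using morph_from_Zero morph_Alg[OF assms] by blast
  then show ?thesis using zero_eq[OF morph_comp[OF g(1) assms]] by simp
qed

lemma morph_const_zero:
  assumes "A \<in> Alg" "B \<in> Alg"
  shows "morph A B (\<lambda>_. zero B)"
proof -
  obtain g where "morph Zero B g" "g point0 = zero B"
    using morph_from_Zero assms by blast
  then show ?thesis using morph_comp[OF morph_to_Zero[OF assms(1)]] by metis
qed

lemma closed_zero: "A \<in> Alg \<Longrightarrow> closed A {zero A}"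
proof -
  assume "A \<in> Alg"
  then obtain g where g: "morph Zero A g" "g point0 = zero A" using morph_from_Zero by blast
  have "closed A (g ` U Zero)" by (rule closed_image[OF closed_full[OF Zero_Alg] g(1)])
  then show ?thesis by (simp add: U_Zero g(2))
qed

lemma zero_in: "A \<in> Alg \<Longrightarrow> zero A \<in> U A"
  using closed_zero closed_subset by blast

lemma zero_sub:
  assumes "closed A S"
  shows "zero (sub A S) = zero A"
  using morph_zero[OF morph_incl[OF assms]] by simp

lemma closed_kernel:
  assumes "morph A B h"
  shows "closed A {x \<in> U A. h x = zero B}"
  using closed_vimage[OF closed_zero assms] morph_Alg[OF assms] by simp

lemma zero_arrow_iff:
  assumes f: "f \<in> hom \<C> A B"
  shows "zero_arrow \<C> f \<longleftrightarrow> (\<forall>x\<in>U A. func f x = zero B)"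
proof
  assume "zero_arrow \<C> f"
  then obtain Z g h where Z: "zero_object \<C> Z" and g: "g \<in> hom \<C> A Z" and h: "h \<in> hom \<C> Z B"
    and fgh: "f = h \<cdot>\<^bsub>\<C>\<^esub> g"
    unfolding zero_arrow_def using hom_source[OF f] hom_target[OF f] by auto
  have "func g x = zero Z" if "x \<in> U A" for x
  proof -
    obtain z where "U Z = {z}" using terminal_trivial Z by (auto simp: zero_object_def)
    moreover have "zero Z \<in> U Z"
      using zero_in morph_Alg[OF hom_morph[OF h]] by blast
    ultimately show ?thesis using morph_in[OF hom_morph[OF g] that] by simp
  qed
  then show "\<forall>x\<in>U A. func f x = zero B"
    using fgh func_comp[of _ g h] hom_source[OF g] morph_zero[OF hom_morph[OF h]] by simp
next
  assume *: "\<forall>x\<in>U A. func f x = zero B"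
  have AB: "A \<in> Alg" "B \<in> Alg" using morph_Alg[OF hom_morph[OF f]] by auto
  have g: "arrow A Zero (\<lambda>_. point0) \<in> hom \<C> A Zero"
    by (rule arrow_hom[OF morph_to_Zero[OF AB(1)]])
  have h: "arrow Zero B (\<lambda>_. zero B) \<in> hom \<C> Zero B"
    by (rule arrow_hom[OF morph_const_zero[OF Zero_Alg AB(2)]])
  have "f = arrow Zero B (\<lambda>_. zero B) \<cdot>\<^bsub>\<C>\<^esub> arrow A Zero (\<lambda>_. point0)"
    by (rule hom_eqI[OF f comp_hom[OF g h]]) (use * U_Zero in \<open>simp add: func_comp\<close>)
  then show "zero_arrow \<C> f"
    unfolding zero_arrow_def variety_simps hom_source[OF f] hom_target[OF f]
    using zero_object_Zero g h hom_Arr[OF f] by blast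
qed

lemma zero_comp_iff:
  assumes g: "g \<in> hom \<C> A B" and h: "h \<in> hom \<C> B D"
  shows "zero_arrow \<C> (h \<cdot>\<^bsub>\<C>\<^esub> g) \<longleftrightarrow> (\<forall>x\<in>U A. func h (func g x) = zero D)"
  using zero_arrow_iff[OF comp_hom[OF g h]] func_comp[of _ g h] hom_source[OF g] by simp


subsection \<open>Protomodularity\<close>

lemma compatible_kernel_pair:
  assumes "morph A D q"
  shows "compatible (\<lambda>x y. q x = q y) A"
  unfolding compatible_def
proof (intro conjI allI impI)
  show "A \<in> Alg" using assms by (simp add: morph_def)
  fix f xs ys
  assume a: "(f, xs) \<in> args (U A) \<and> (f, ys) \<in> args (U A) \<and> list_all2 (\<lambda>x y. q x = q y) xs ys"
  then have "map q xs = map q ys"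
    by (auto simp: list_all2_conv_all_nth intro: nth_equalityI)
  then show "q (oper A f xs) = q (oper A f ys)"
    using morph_oper[OF assms, of f xs] morph_oper[OF assms, of f ys] a by presburger
qed

lemma compatible_conj:
  assumes "compatible P A" "compatible R A"
  shows "compatible (\<lambda>x y. P x y \<and> R x y) A"
  using assms list_all2_mono[of "\<lambda>x y. P x y \<and> R x y" _ _ P]
    list_all2_mono[of "\<lambda>x y. P x y \<and> R x y" _ _ R]
  unfolding compatible_def by blast

lemma iso_surj:
  assumes f: "f \<in> hom \<C> A B" and iso: "iso \<C> f" and y: "y \<in> U B"
  shows "\<exists>x\<in>U A. func f x = y"
proof -
  obtain g where g: "g \<in> hom \<C> B A" and fg: "f \<cdot>\<^bsub>\<C>\<^esub> g = Ident \<C> B"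
    using iso hom_source[OF f] hom_target[OF f] by (auto simp: iso_def)
  have "func f (func g y) = y"
    using func_comp[of y g f] fg func_Ident[OF y] y hom_source[OF g] by simp
  then show ?thesis using morph_in[OF hom_morph[OF g] y] by blast
qed

lemma iso_Ident:
  assumes "A \<in> Alg"
  shows "iso \<C> (Ident \<C> A)"
proof -
  have i: "Ident \<C> A \<in> hom \<C> A A"
    unfolding Ident_arrow by (rule arrow_hom[OF morph_id[OF assms]])
  have "Ident \<C> A \<cdot>\<^bsub>\<C>\<^esub> Ident \<C> A = Ident \<C> A"
    by (rule hom_eqI[OF comp_hom[OF i i] i]) (simp add: func_comp hom_source[OF i] func_Ident)
  then show ?thesis
    unfolding iso_def variety_simps hom_source[OF i] hom_target[OF i]
    using i hom_Arr[OF i] by metis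
qed

definition zero_class :: "('u \<Rightarrow> 'u \<Rightarrow> bool) \<Rightarrow> 'u algebra \<Rightarrow> 'u set" where
  "zero_class P A = {y \<in> U A. P (zero A) y}"

lemma closed_zero_class:
  assumes "compatible P A"
  shows "closed A (zero_class P A)"
proof -
  have A: "A \<in> Alg" using assms by (simp add: compatible_def)
  have "zero_class P A = proj2 ` {p \<in> U (relalg P A). proj1 p \<in> {zero A}}"
    using zero_in[OF A] by (force simp: zero_class_def pairs_def image_iff)
  then show ?thesis
    using closed_image[OF closed_vimage[OF closed_zero[OF A] morph_proj(1)[OF assms]]
        morph_proj(2)[OF assms]] by simp
qed

text \<open>
  The first projection of a reflexive compatible relation, split by the diagonal, is a point
  over \<open>A\<close>; its pullback along the inclusion of zero is the class of zero.
\<close>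

lemma point_relalg:
  assumes P: "compatible P A" and refl: "\<And>x. x \<in> U A \<Longrightarrow> P x x"
  shows "point \<C> (arrow (relalg P A) A proj1) (arrow A (relalg P A) (\<lambda>x. kpair x x))"
proof -
  have A: "A \<in> Alg" using P by (simp add: compatible_def)
  have p: "arrow (relalg P A) A proj1 \<in> hom \<C> (relalg P A) A"
    by (rule arrow_hom[OF morph_proj(1)[OF P]])
  have s: "arrow A (relalg P A) (\<lambda>x. kpair x x) \<in> hom \<C> A (relalg P A)"
    by (rule arrow_hom[OF morph_kpair[OF P morph_id[OF A] morph_id[OF A] refl]])
  have i: "Ident \<C> A \<in> hom \<C> A A"
    unfolding Ident_arrow by (rule arrow_hom[OF morph_id[OF A]])
  have "arrow (relalg P A) A proj1 \<cdot>\<^bsub>\<C>\<^esub> arrow A (relalg P A) (\<lambda>x. kpair x x) = Ident \<C> A"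
    by (rule hom_eqI[OF comp_hom[OF s p] i])
      (use refl in \<open>auto simp: func_comp func_Ident pairs_def\<close>)
  then show ?thesis
    using hom_Arr[OF p] s by (simp add: point_def)
qed

lemma pullback_zero_class:
  assumes P: "compatible P A"
  defines "N \<equiv> zero_class P A"
  shows "pullback \<C> (arrow (relalg P A) A proj1) (arrow Zero A (\<lambda>_. zero A))
    (arrow (sub A N) (relalg P A) (kpair (zero A))) (arrow (sub A N) Zero (\<lambda>_. point0))"
proof -
  let ?p = "arrow (relalg P A) A proj1" and ?v = "arrow Zero A (\<lambda>_. zero A)"
  let ?a = "arrow (sub A N) (relalg P A) (kpair (zero A))"
  let ?e = "arrow (sub A N) Zero (\<lambda>_. point0)"
  have A: "A \<in> Alg" using P by (simp add: compatible_def)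
  have N: "closed A N" unfolding N_def by (rule closed_zero_class[OF P])
  have p: "?p \<in> hom \<C> (relalg P A) A"
    by (rule arrow_hom[OF morph_proj(1)[OF P]])
  have v: "?v \<in> hom \<C> Zero A"
    by (rule arrow_hom[OF morph_const_zero[OF Zero_Alg A]])
  have a: "?a \<in> hom \<C> (sub A N) (relalg P A)"
    by (rule arrow_hom[OF morph_kpair[OF P morph_const_zero[OF sub_Alg[OF N] A] morph_incl[OF N]]])
      (use N in \<open>simp add: N_def zero_class_def\<close>)
  have e: "?e \<in> hom \<C> (sub A N) Zero"
    by (rule arrow_hom[OF morph_to_Zero[OF sub_Alg[OF N]]])
  have UN: "U (sub A N) = N" using N by simp
  have kN: "kpair (zero A) y \<in> pairs P A" if "y \<in> N" for y
    using that zero_in[OF A] by (auto simp: N_def zero_class_def pairs_def)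
  have square: "?p \<cdot>\<^bsub>\<C>\<^esub> ?a = ?v \<cdot>\<^bsub>\<C>\<^esub> ?e"
    by (rule comp_eqI[OF a p e v]) (simp add: UN kN U_Zero)
  have universal: "\<exists>!t. t \<in> hom \<C> X (sub A N) \<and> ?a \<cdot>\<^bsub>\<C>\<^esub> t = g \<and> ?e \<cdot>\<^bsub>\<C>\<^esub> t = h"
    if g: "g \<in> hom \<C> X (relalg P A)" and h: "h \<in> hom \<C> X Zero"
      and eq: "?p \<cdot>\<^bsub>\<C>\<^esub> g = ?v \<cdot>\<^bsub>\<C>\<^esub> h" for X g h
  proof -
    have gx: "proj2 (func g x) \<in> N \<and> kpair (zero A) (proj2 (func g x)) = func g x"
      if x: "x \<in> U X" for x
    proof -
      have "func g x \<in> pairs P A" using morph_in[OF hom_morph[OF g] x] by simp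
      moreover have "func h x \<in> U Zero" using morph_in[OF hom_morph[OF h] x] .
      moreover have "func ?p (func g x) = func ?v (func h x)"
        by (rule comp_eqD[OF eq g h x])
      ultimately have "proj1 (func g x) = zero A" "func g x \<in> pairs P A" by simp_all
      then show ?thesis by (auto simp: pairs_def N_def zero_class_def)
    qed
    have t: "arrow X (sub A N) (\<lambda>x. proj2 (func g x)) \<in> hom \<C> X (sub A N)"
      using gx by (intro arrow_hom morph_into_sub[OF N] morph_comp[OF hom_morph[OF g] morph_proj(2)[OF P]])
        simp
    show ?thesis
    proof (rule ex1I, intro conjI)
      show "arrow X (sub A N) (\<lambda>x. proj2 (func g x)) \<in> hom \<C> X (sub A N)" by (rule t)
      show "?a \<cdot>\<^bsub>\<C>\<^esub> arrow X (sub A N) (\<lambda>x. proj2 (func g x)) = g"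
        by (rule hom_eqI[OF comp_hom[OF t a] g]) (use gx UN in \<open>simp add: func_comp\<close>)
      show "?e \<cdot>\<^bsub>\<C>\<^esub> arrow X (sub A N) (\<lambda>x. proj2 (func g x)) = h"
        by (rule hom_eqI[OF comp_hom[OF t e] h])
          (use gx UN U_Zero morph_in[OF hom_morph[OF h]] in \<open>simp add: func_comp\<close>)
      fix t' assume t': "t' \<in> hom \<C> X (sub A N) \<and> ?a \<cdot>\<^bsub>\<C>\<^esub> t' = g \<and> ?e \<cdot>\<^bsub>\<C>\<^esub> t' = h"
      show "t' = arrow X (sub A N) (\<lambda>x. proj2 (func g x))"
      proof (rule hom_eqI[OF _ t])
        show t'h: "t' \<in> hom \<C> X (sub A N)" using t' by blast
        fix x assume x: "x \<in> U X"
        have "func t' x \<in> U (sub A N)" by (rule morph_in[OF hom_morph[OF t'h] x])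
        moreover have "func ?a (func t' x) = func g x"
          using func_comp[of x t' ?a] x t' hom_source[OF t'h] by simp
        ultimately show "func t' x = func (arrow X (sub A N) (\<lambda>x. proj2 (func g x))) x"
          using x by (metis func_arrow proj_kpair(2))
      qed
    qed
  qed
  show ?thesis
    unfolding pullback_def variety_simps arrow_sel
    using hom_Arr[OF p] hom_Arr[OF v] hom_Arr[OF a] hom_Arr[OF e] square universal by auto
qed

text \<open>
  The inclusion of \<open>P\<close> into \<open>R\<close> is a morphism of points over \<open>A\<close>.  If the classes of zero agree, its
  pullback along the inclusion of zero is the identity, so by protomodularity it is invertible,
  hence onto.
\<close>

lemma relation_determined_by_zero_class:
  assumes P: "compatible P A" and R: "compatible R A"
    and refl: "\<And>x. x \<in> U A \<Longrightarrow> P x x"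
    and sub: "\<And>x y. P x y \<Longrightarrow> R x y"
    and zero: "zero_class R A \<subseteq> zero_class P A"
    and xy: "x \<in> U A" "y \<in> U A" "R x y"
  shows "P x y"
proof -
  have A: "A \<in> Alg" using P by (simp add: compatible_def)
  have R_refl: "R x x" if "x \<in> U A" for x using refl sub that by blast
  have N: "zero_class R A = zero_class P A"
    using zero sub by (auto simp: zero_class_def)
  let ?N = "sub A (zero_class P A)"
  let ?p = "\<lambda>P. arrow (relalg P A) A proj1" and ?s = "\<lambda>P. arrow A (relalg P A) (\<lambda>x. kpair x x)"
  let ?a = "\<lambda>P. arrow ?N (relalg P A) (kpair (zero A))"
  let ?e = "arrow ?N Zero (\<lambda>_. point0)"
  let ?f = "arrow (relalg P A) (relalg R A) (\<lambda>x. x)"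
  have pairs_sub: "pairs P A \<subseteq> pairs R A" using sub by (auto simp: pairs_def)
  have "morph (relalg P A) (relalg R A) (\<lambda>p. kpair (proj1 p) (proj2 p))"
    by (rule morph_kpair[OF R morph_proj[OF P]]) (use sub in \<open>auto simp: pairs_def\<close>)
  then have "morph (relalg P A) (relalg R A) (\<lambda>x. x)"
    by (rule morph_cong) (auto simp: pairs_def)
  then have f: "?f \<in> hom \<C> (relalg P A) (relalg R A)" by (rule arrow_hom)
  have p: "?p P \<in> hom \<C> (relalg P A) A" by (rule arrow_hom[OF morph_proj(1)[OF P]])
  have p': "?p R \<in> hom \<C> (relalg R A) A" by (rule arrow_hom[OF morph_proj(1)[OF R]])
  have s: "?s P \<in> hom \<C> A (relalg P A)"
    by (rule arrow_hom[OF morph_kpair[OF P morph_id[OF A] morph_id[OF A] refl]])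
  have s': "?s R \<in> hom \<C> A (relalg R A)"
    by (rule arrow_hom[OF morph_kpair[OF R morph_id[OF A] morph_id[OF A] R_refl]])
  have pf: "?p R \<cdot>\<^bsub>\<C>\<^esub> ?f = ?p P"
    by (rule hom_eqI[OF comp_hom[OF f p'] p])
      (use pairs_sub in \<open>simp add: func_comp subset_iff\<close>)
  have fs: "?f \<cdot>\<^bsub>\<C>\<^esub> ?s P = ?s R"
    by (rule hom_eqI[OF comp_hom[OF s f] s']) (use refl in \<open>auto simp: func_comp pairs_def\<close>)
  have point: "point_morphism \<C> (?p P) (?s P) (?p R) (?s R) ?f"
    using point_relalg[OF P refl] point_relalg[OF R R_refl] f pf fs
    by (simp add: point_morphism_def)
  have cN: "closed A (zero_class P A)" by (rule closed_zero_class[OF P])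
  have pb: "pullback \<C> (?p P) (arrow Zero A (\<lambda>_. zero A)) (?a P) ?e"
    by (rule pullback_zero_class[OF P])
  have pb': "pullback \<C> (?p R) (arrow Zero A (\<lambda>_. zero A)) (?a R) ?e"
    using pullback_zero_class[OF R] unfolding N .
  have i: "Ident \<C> ?N \<in> hom \<C> ?N ?N"
    unfolding Ident_arrow by (rule arrow_hom[OF morph_id[OF sub_Alg[OF cN]]])
  have e: "?e \<in> hom \<C> ?N Zero"
    by (rule arrow_hom[OF morph_to_Zero[OF sub_Alg[OF cN]]])
  have in_P: "kpair (zero A) y \<in> pairs P A" if "y \<in> zero_class P A" for y
    using that zero_in[OF A] by (auto simp: zero_class_def pairs_def)
  have a: "?a P \<in> hom \<C> ?N (relalg P A)"
    by (rule arrow_hom[OF morph_kpair[OF P morph_const_zero[OF sub_Alg[OF cN] A] morph_incl[OF cN]]])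
      (use cN in \<open>simp add: zero_class_def\<close>)
  have a': "?a R \<in> hom \<C> ?N (relalg R A)"
    by (rule arrow_hom[OF morph_kpair[OF R morph_const_zero[OF sub_Alg[OF cN] A] morph_incl[OF cN]]])
      (use cN sub in \<open>simp add: zero_class_def\<close>)
  have sq1: "?a R \<cdot>\<^bsub>\<C>\<^esub> Ident \<C> ?N = ?f \<cdot>\<^bsub>\<C>\<^esub> ?a P"
    by (rule comp_eqI[OF i a' a f]) (use cN in_P in \<open>simp add: func_Ident\<close>)
  have sq2: "?e \<cdot>\<^bsub>\<C>\<^esub> Ident \<C> ?N = ?e"
    by (rule hom_eqI[OF comp_hom[OF i e] e]) (simp add: func_comp hom_source[OF i] func_Ident)
  have "iso \<C> ?f"
  proof -
    have "Bourn_protomodular \<C>" using semi_abelian by (simp add: semi_abelian_def)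
    then have "\<And>p s p' s' f v a e a' e' g.
        point_morphism \<C> p s p' s' f \<and> pullback \<C> p v a e \<and> pullback \<C> p' v a' e' \<and>
        g \<in> hom \<C> (Dom \<C> a) (Dom \<C> a') \<and> a' \<cdot>\<^bsub>\<C>\<^esub> g = f \<cdot>\<^bsub>\<C>\<^esub> a \<and> e' \<cdot>\<^bsub>\<C>\<^esub> g = e \<and>
        iso \<C> g \<Longrightarrow> iso \<C> f"
      unfolding Bourn_protomodular_def by blast
    moreover have "Ident \<C> ?N \<in> hom \<C> (Dom \<C> (?a P)) (Dom \<C> (?a R))" using i by simp
    ultimately show ?thesis
      using point pb pb' sq1 sq2 iso_Ident[OF sub_Alg[OF cN]] by blast
  qed
  moreover have "kpair x y \<in> U (relalg R A)" using xy by (auto simp: pairs_def)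
  ultimately obtain w where "w \<in> U (relalg P A)" "func ?f w = kpair x y"
    using iso_surj[OF f] by blast
  then show ?thesis by (auto simp: pairs_def)
qed

text \<open>
  The kernel pair of \<open>q\<close> and the common kernel pair of \<open>q\<close> and \<open>g\<close> are reflexive compatible relations
  with the same class of zero, so they coincide.
\<close>

lemma fibres_from_kernel:
  assumes q: "morph A D q" and g: "morph A X g"
    and kill: "\<And>x. x \<in> U A \<Longrightarrow> q x = zero D \<Longrightarrow> g x = zero X"
    and xy: "x \<in> U A" "y \<in> U A" "q x = q y"
  shows "g x = g y"
proof -
  have "q x = q y \<and> g x = g y"
  proof (rule relation_determined_by_zero_class[of "\<lambda>x y. q x = q y \<and> g x = g y" A "\<lambda>x y. q x = q y"])
    show "compatible (\<lambda>x y. q x = q y \<and> g x = g y) A"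
      by (rule compatible_conj[OF compatible_kernel_pair[OF q] compatible_kernel_pair[OF g]])
    show "zero_class (\<lambda>x y. q x = q y) A \<subseteq> zero_class (\<lambda>x y. q x = q y \<and> g x = g y) A"
      using kill morph_zero[OF q] morph_zero[OF g] by (auto simp: zero_class_def)
  qed (use xy compatible_kernel_pair[OF q] in auto)
  then show ?thesis by simp
qed


subsection \<open>Short exact sequences in terms of elements\<close>

definition exact :: "'u algebra \<Rightarrow> 'u algebra \<Rightarrow> 'u algebra \<Rightarrow> ('u \<Rightarrow> 'u) \<Rightarrow> ('u \<Rightarrow> 'u) \<Rightarrow> bool" where
  "exact A B D k q \<longleftrightarrow> morph A B k \<and> morph B D q \<and> inj_on k (U A) \<and>
     k ` U A = {y \<in> U B. q y = zero D} \<and> q ` U B = U D"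

lemma exact_factor_kernel:
  assumes ex: "exact A B D k q" and g: "morph X B g" and zero: "\<And>x. x \<in> U X \<Longrightarrow> q (g x) = zero D"
  obtains t where "morph X A t" "\<And>x. x \<in> U X \<Longrightarrow> k (t x) = g x"
proof
  have k: "morph A B k" and inj: "inj_on k (U A)" and im: "k ` U A = {y \<in> U B. q y = zero D}"
    using ex by (auto simp: exact_def)
  define t where "t x = inv_into (U A) k (g x)" for x
  have gx: "g x \<in> k ` U A" if "x \<in> U X" for x
    unfolding im using zero that morph_in[OF g] by simp
  show kt: "k (t x) = g x" if "x \<in> U X" for x
    unfolding t_def by (rule f_inv_into_f[OF gx[OF that]])
  have t_in: "t x \<in> U A" if "x \<in> U X" for x
    unfolding t_def by (rule inv_into_into[OF gx[OF that]])
  show "morph X A t"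
  proof (rule morphI)
    show XA: "X \<in> Alg" "A \<in> Alg" using morph_Alg g k by auto
    show "t x \<in> U A" if "x \<in> U X" for x using t_in that .
    fix f xs assume a: "(f, xs) \<in> args (U X)"
    then have b: "(f, map t xs) \<in> args (U A)" using t_in by auto
    have eq: "map k (map t xs) = map g xs" using kt a by auto
    have "k (oper A f (map t xs)) = oper B f (map g xs)"
      unfolding morph_oper[OF k b] eq ..
    also have "\<dots> = k (t (oper X f xs))"
      unfolding kt[OF Alg_oper[OF XA(1) a]] morph_oper[OF g a] ..
    finally show "t (oper X f xs) = oper A f (map t xs)"
      using inj t_in[OF Alg_oper[OF XA(1) a]] Alg_oper[OF XA(2) b] by (metis inj_onD)
  qed
qed

text \<open>
  The function induced on the quotient is well defined by \<open>fibres_from_kernel\<close>.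
\<close>

lemma exact_factor_cokernel:
  assumes ex: "exact A B D k q" and g: "morph B X g" and zero: "\<And>x. x \<in> U A \<Longrightarrow> g (k x) = zero X"
  obtains t where "morph D X t" "\<And>y. y \<in> U B \<Longrightarrow> t (q y) = g y"
proof
  have q: "morph B D q" and im: "k ` U A = {y \<in> U B. q y = zero D}" and onto: "q ` U B = U D"
    using ex by (auto simp: exact_def)
  define s where "s z = inv_into (U B) q z" for z
  define t where "t z = g (s z)" for z
  have s_in: "s z \<in> U B" and qs: "q (s z) = z" if "z \<in> U D" for z
    unfolding s_def using that onto by (auto intro: inv_into_into f_inv_into_f)
  have "g y = zero X" if "y \<in> U B" "q y = zero D" for y
  proof -
    have "y \<in> k ` U A" unfolding im using that by simp
    then show ?thesis using zero by blast
  qed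
  then have fib: "g x = g y" if "x \<in> U B" "y \<in> U B" "q x = q y" for x y
    using fibres_from_kernel[OF q g] that by blast
  show tq: "t (q y) = g y" if "y \<in> U B" for y
    unfolding t_def using that morph_in[OF q that] by (intro fib s_in qs)
  show "morph D X t"
  proof (rule morphI)
    show DX: "D \<in> Alg" "X \<in> Alg" using morph_Alg g q by auto
    show "t z \<in> U X" if "z \<in> U D" for z
      unfolding t_def using s_in[OF that] morph_in[OF g] by blast
    fix f zs assume a: "(f, zs) \<in> args (U D)"
    then have b: "(f, map s zs) \<in> args (U B)" using s_in by auto
    have B: "B \<in> Alg" using morph_Alg q by blast
    have "q (oper B f (map s zs)) = oper D f (map q (map s zs))"
      by (rule morph_oper[OF q b])
    also have "map q (map s zs) = zs"
      unfolding map_map comp_def by (rule map_idI) (use qs a in auto)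
    finally have "t (oper D f zs) = g (oper B f (map s zs))"
      using tq[OF Alg_oper[OF B b]] by simp
    also have "\<dots> = oper X f (map g (map s zs))" by (rule morph_oper[OF g b])
    also have "map g (map s zs) = map t zs" by (simp add: t_def)
    finally show "t (oper D f zs) = oper X f (map t zs)" .
  qed
qed

text \<open>
  The inclusion of the set of elements sent to zero is a concrete kernel; comparing \<open>k\<close> with it gives
  both injectivity and the image.
\<close>

lemma kernel_elements:
  assumes k: "k \<in> hom \<C> A B" and q: "q \<in> hom \<C> B D" and ker: "kernel \<C> k q"
  shows "inj_on (func k) (U A)" "func k ` U A = {y \<in> U B. func q y = zero D}"
proof -
  let ?S = "{y \<in> U B. func q y = zero D}"
  have A: "A \<in> Alg" using morph_Alg[OF hom_morph[OF k]] by simp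
  have qk: "func q (func k x) = zero D" if "x \<in> U A" for x
    using ker zero_comp_iff[OF k q] that by (auto simp: kernel_def)
  have univ: "\<exists>!h. h \<in> hom \<C> X A \<and> k \<cdot>\<^bsub>\<C>\<^esub> h = g"
    if g: "g \<in> hom \<C> X B" and "\<And>x. x \<in> U X \<Longrightarrow> func q (func g x) = zero D" for X g
  proof -
    have zero: "zero_arrow \<C> (q \<cdot>\<^bsub>\<C>\<^esub> g)" using zero_comp_iff[OF g q] that by blast
    have all: "\<forall>g\<in>Arr \<C>. target g = B \<and> zero_arrow \<C> (q \<cdot>\<^bsub>\<C>\<^esub> g) \<longrightarrow>
        (\<exists>!h. h \<in> hom \<C> (source g) A \<and> k \<cdot>\<^bsub>\<C>\<^esub> h = g)"
      using ker hom_source[OF k] hom_source[OF q] by (simp add: kernel_def)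
    show ?thesis
      using bspec[OF all hom_Arr[OF g]] zero by (simp add: hom_source[OF g] hom_target[OF g])
  qed
  have S: "closed B ?S" by (rule closed_kernel[OF hom_morph[OF q]])
  let ?i = "arrow (sub B ?S) B (\<lambda>x. x)"
  have i: "?i \<in> hom \<C> (sub B ?S) B" by (rule arrow_hom[OF morph_incl[OF S]])
  obtain h where h: "h \<in> hom \<C> (sub B ?S) A" and kh: "k \<cdot>\<^bsub>\<C>\<^esub> h = ?i"
    using univ[OF i] S by auto
  have kh': "func k (func h y) = y" if "y \<in> ?S" for y
    using func_comp[of y h k] kh that hom_source[OF h] S by simp
  have k_in: "func k x \<in> ?S" if "x \<in> U A" for x
    using qk[OF that] morph_in[OF hom_morph[OF k] that] by simp
  show "func k ` U A = ?S"
  proof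
    show "func k ` U A \<subseteq> ?S" using k_in by blast
    show "?S \<subseteq> func k ` U A"
    proof
      fix y assume y: "y \<in> ?S"
      then have "func h y \<in> U A" using morph_in[OF hom_morph[OF h], of y] S by simp
      then show "y \<in> func k ` U A" using kh'[OF y] by (metis image_eqI)
    qed
  qed
  \<comment> \<open>Both the identity and the retraction of \<open>k\<close> built from \<open>h\<close> factor \<open>k\<close> through itself.\<close>
  have "morph A (sub B ?S) (func k)"
    by (rule morph_into_sub[OF S hom_morph[OF k] k_in])
  then have r: "arrow A A (\<lambda>x. func h (func k x)) \<in> hom \<C> A A"
    by (rule arrow_hom[OF morph_comp[OF _ hom_morph[OF h]]])
  have id: "arrow A A (\<lambda>x. x) \<in> hom \<C> A A" by (rule arrow_hom[OF morph_id[OF A]])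
  have "k \<cdot>\<^bsub>\<C>\<^esub> arrow A A (\<lambda>x. func h (func k x)) = k"
    by (rule hom_eqI[OF comp_hom[OF r k] k]) (use kh' k_in in \<open>simp add: func_comp\<close>)
  moreover have "k \<cdot>\<^bsub>\<C>\<^esub> arrow A A (\<lambda>x. x) = k"
    by (rule hom_eqI[OF comp_hom[OF id k] k]) (simp add: func_comp)
  ultimately have "arrow A A (\<lambda>x. func h (func k x)) = arrow A A (\<lambda>x. x)"
    using univ[OF k qk] r id by blast
  then have "func h (func k x) = x" if "x \<in> U A" for x
    using func_arrow[OF that] by metis
  then show "inj_on (func k) (U A)" by (rule inj_on_inverseI)
qed

text \<open>
  The cokernel factors through its own image, and the uniqueness part of its universal property
  forces that image to be everything.
\<close>

lemma cokernel_surj: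
  assumes k: "k \<in> hom \<C> A B" and q: "q \<in> hom \<C> B D" and coker: "cokernel \<C> q k"
  shows "func q ` U B = U D"
proof
  let ?I = "func q ` U B"
  have BD: "B \<in> Alg" "D \<in> Alg" using morph_Alg[OF hom_morph[OF q]] by simp_all
  have qk: "func q (func k x) = zero D" if "x \<in> U A" for x
    using coker zero_comp_iff[OF k q] that by (auto simp: cokernel_def)
  have univ: "\<exists>!h. h \<in> hom \<C> D X \<and> h \<cdot>\<^bsub>\<C>\<^esub> q = g"
    if g: "g \<in> hom \<C> B X" and "\<And>x. x \<in> U A \<Longrightarrow> func g (func k x) = zero X" for X g
  proof -
    have zero: "zero_arrow \<C> (g \<cdot>\<^bsub>\<C>\<^esub> k)" using zero_comp_iff[OF k g] that by blast
    have all: "\<forall>g\<in>Arr \<C>. B = source g \<and> zero_arrow \<C> (g \<cdot>\<^bsub>\<C>\<^esub> k) \<longrightarrow>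
        (\<exists>!h. h \<in> hom \<C> D (target g) \<and> h \<cdot>\<^bsub>\<C>\<^esub> q = g)"
      using coker hom_target[OF k] hom_target[OF q] by (simp add: cokernel_def)
    show ?thesis
      using bspec[OF all hom_Arr[OF g]] zero by (simp add: hom_source[OF g] hom_target[OF g])
  qed
  have I: "closed D ?I" by (rule closed_image[OF closed_full[OF BD(1)] hom_morph[OF q]])
  show "?I \<subseteq> U D" by (rule closed_subset[OF I])
  let ?q = "arrow B (sub D ?I) (func q)"
  have q': "?q \<in> hom \<C> B (sub D ?I)"
    by (rule arrow_hom[OF morph_into_sub[OF I hom_morph[OF q]]]) simp
  have "func ?q (func k x) = zero (sub D ?I)" if "x \<in> U A" for x
    using qk[OF that] morph_in[OF hom_morph[OF k] that] zero_sub[OF I] by simp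
  then obtain t where t: "t \<in> hom \<C> D (sub D ?I)" and tq: "t \<cdot>\<^bsub>\<C>\<^esub> q = ?q"
    using univ[OF q'] by blast
  \<comment> \<open>Corestricting \<open>q\<close> to its image and including back yields \<open>q\<close>, so \<open>t\<close> fixes all elements.\<close>
  have t': "arrow D D (func t) \<in> hom \<C> D D"
    by (rule arrow_hom) (use morph_comp[OF hom_morph[OF t] morph_incl[OF I]] in simp)
  have id: "arrow D D (\<lambda>x. x) \<in> hom \<C> D D" by (rule arrow_hom[OF morph_id[OF BD(2)]])
  have tq': "func t (func q y) = func q y" if "y \<in> U B" for y
    using func_comp[of y q t] that tq hom_source[OF q] by simp
  have q_in: "func q y \<in> U D" if "y \<in> U B" for y by (rule morph_in[OF hom_morph[OF q] that])
  have "arrow D D (func t) \<cdot>\<^bsub>\<C>\<^esub> q = q"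
    by (rule hom_eqI[OF comp_hom[OF q t'] q]) (use tq' q_in hom_source[OF q] in \<open>simp add: func_comp\<close>)
  moreover have "arrow D D (\<lambda>x. x) \<cdot>\<^bsub>\<C>\<^esub> q = q"
    by (rule hom_eqI[OF comp_hom[OF q id] q]) (use q_in hom_source[OF q] in \<open>simp add: func_comp\<close>)
  ultimately have "arrow D D (func t) = arrow D D (\<lambda>x. x)"
    using univ[OF q qk] t' id by blast
  then have "func t z = z" if "z \<in> U D" for z
    using func_arrow[OF that] by metis
  then show "U D \<subseteq> ?I"
    using morph_in[OF hom_morph[OF t]] I by force
qed

lemma short_exact_iff:
  assumes k: "k \<in> hom \<C> A B" and q: "q \<in> hom \<C> B D"
  shows "short_exact \<C> k q \<longleftrightarrow> exact A B D (func k) (func q)"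
proof
  assume "short_exact \<C> k q"
  then show "exact A B D (func k) (func q)"
    using kernel_elements[OF k q] cokernel_surj[OF k q] hom_morph[OF k] hom_morph[OF q]
    by (simp add: short_exact_def exact_def)
next
  assume ex: "exact A B D (func k) (func q)"
  have qk: "func q (func k x) = zero D" if "x \<in> U A" for x
    using ex that by (auto simp: exact_def)
  have zero: "zero_arrow \<C> (q \<cdot>\<^bsub>\<C>\<^esub> k)" using zero_comp_iff[OF k q] qk by blast
  have "\<exists>!h. h \<in> hom \<C> (source g) A \<and> k \<cdot>\<^bsub>\<C>\<^esub> h = g"
    if "g \<in> Arr \<C>" "target g = B" "zero_arrow \<C> (q \<cdot>\<^bsub>\<C>\<^esub> g)" for g
  proof -
    let ?X = "source g"
    have g: "g \<in> hom \<C> ?X B" using that by (simp add: hom_def)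
    have "\<forall>x\<in>U ?X. func q (func g x) = zero D" using zero_comp_iff[OF g q] that by blast
    then obtain t where t: "morph ?X A t" "\<And>x. x \<in> U ?X \<Longrightarrow> func k (t x) = func g x"
      using exact_factor_kernel[OF ex hom_morph[OF g]] by blast
    have kt: "k \<cdot>\<^bsub>\<C>\<^esub> arrow ?X A t = g"
      by (rule hom_eqI[OF comp_hom[OF arrow_hom[OF t(1)] k] g]) (simp add: func_comp t(2))
    show ?thesis
    proof (rule ex1I, intro conjI)
      show "arrow ?X A t \<in> hom \<C> ?X A" by (rule arrow_hom[OF t(1)])
      show "k \<cdot>\<^bsub>\<C>\<^esub> arrow ?X A t = g" by (rule kt)
      fix h assume h: "h \<in> hom \<C> ?X A \<and> k \<cdot>\<^bsub>\<C>\<^esub> h = g"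
      show "h = arrow ?X A t"
      proof (rule hom_eqI[OF _ arrow_hom[OF t(1)]])
        show hh: "h \<in> hom \<C> ?X A" using h by simp
        fix x assume x: "x \<in> U ?X"
        have "func k (func h x) = func k (t x)"
          using func_comp[of x h k] h x hom_source[OF hh] t(2) by simp
        moreover have "inj_on (func k) (U A)" using ex by (simp add: exact_def)
        ultimately have "func h x = t x"
          using morph_in[OF hom_morph[OF hh] x] morph_in[OF t(1) x] by (simp add: inj_on_eq_iff)
        then show "func h x = func (arrow ?X A t) x" using x by simp
      qed
    qed
  qed
  then have ker: "kernel \<C> k q"
    unfolding kernel_def variety_simps hom_source[OF k] hom_target[OF k] hom_source[OF q]
    using hom_Arr[OF k] hom_Arr[OF q] zero by blast
  have "\<exists>!h. h \<in> hom \<C> D (target g) \<and> h \<cdot>\<^bsub>\<C>\<^esub> q = g"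
    if "g \<in> Arr \<C>" "B = source g" "zero_arrow \<C> (g \<cdot>\<^bsub>\<C>\<^esub> k)" for g
  proof -
    let ?X = "target g"
    have g: "g \<in> hom \<C> B ?X" using that by (simp add: hom_def)
    have "\<forall>x\<in>U A. func g (func k x) = zero ?X" using zero_comp_iff[OF k g] that by blast
    then obtain t where t: "morph D ?X t" "\<And>y. y \<in> U B \<Longrightarrow> t (func q y) = func g y"
      using exact_factor_cokernel[OF ex hom_morph[OF g]] by blast
    have tq: "arrow D ?X t \<cdot>\<^bsub>\<C>\<^esub> q = g"
      by (rule hom_eqI[OF comp_hom[OF q arrow_hom[OF t(1)]] g])
        (simp add: func_comp hom_source[OF q] t(2) morph_in[OF hom_morph[OF q]])
    show ?thesis
    proof (rule ex1I, intro conjI)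
      show "arrow D ?X t \<in> hom \<C> D ?X" by (rule arrow_hom[OF t(1)])
      show "arrow D ?X t \<cdot>\<^bsub>\<C>\<^esub> q = g" by (rule tq)
      fix h assume h: "h \<in> hom \<C> D ?X \<and> h \<cdot>\<^bsub>\<C>\<^esub> q = g"
      show "h = arrow D ?X t"
      proof (rule hom_eqI[OF _ arrow_hom[OF t(1)]])
        show hh: "h \<in> hom \<C> D ?X" using h by simp
        fix z assume z: "z \<in> U D"
        moreover have "func q ` U B = U D" using ex by (simp add: exact_def)
        ultimately obtain y where y: "y \<in> U B" "z = func q y" by blast
        have "func h (func q y) = func g y"
          using func_comp[of y q h] h y(1) hom_source[OF q] by simp
        then show "func h z = func (arrow D ?X t) z" using z y t(2) by simp
      qed
    qed
  qed
  then have "cokernel \<C> q k"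
    unfolding cokernel_def variety_simps hom_source[OF q] hom_target[OF k] hom_target[OF q]
    using hom_Arr[OF k] hom_Arr[OF q] zero by blast
  with ker show "short_exact \<C> k q" by (simp add: short_exact_def)
qed

end


section \<open>Three by three diagrams\<close>

text \<open>
  The definition of a three by three diagram is symmetric in rows and columns, so that one half of
  the longer verifications below follows from the other by transposition.
\<close>

definition transpose :: "('o, 'a) diagram \<Rightarrow> ('o, 'a) diagram" where
  "transpose D = \<lparr>node = (\<lambda>i j. node D j i), row_k = col_k D, row_q = col_q D,
     col_k = row_k D, col_q = row_q D\<rparr>"

lemma transpose_sel [simp]:
  "node (transpose D) i j = node D j i"
  "row_k (transpose D) = col_k D" "row_q (transpose D) = col_q D"
  "col_k (transpose D) = row_k D" "col_q (transpose D) = row_q D"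
  by (simp_all add: transpose_def)

lemma transpose_three_by_three:
  "D \<in> three_by_three C K Q \<Longrightarrow> transpose D \<in> three_by_three C K Q"
  by (simp add: three_by_three_def)

context semi_abelian_variety
begin

abbreviation row_kf where "row_kf D i \<equiv> func (row_k D i)"
abbreviation row_qf where "row_qf D i \<equiv> func (row_q D i)"
abbreviation col_kf where "col_kf D j \<equiv> func (col_k D j)"
abbreviation col_qf where "col_qf D j \<equiv> func (col_q D j)"
abbreviation Y where "Y D \<equiv> node D Two Two"

abbreviation "\<D> K Q \<equiv> three_by_three \<C> K Q"

definition into :: "('u algebra, 'u homomorphism) diagram \<Rightarrow> 'u \<Rightarrow> 'u" where
  "into D x = col_kf D Two (row_kf D One x)"

definition out :: "('u algebra, 'u homomorphism) diagram \<Rightarrow> 'u \<Rightarrow> 'u" where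
  "out D y = row_qf D Three (col_qf D Two y)"

lemma diagram_corners:
  assumes "D \<in> \<D> K Q"
  shows "node D One One = K" "node D Three Three = Q"
  using assms by (simp_all add: three_by_three_def)

lemma row_exact:
  assumes "D \<in> \<D> K Q"
  shows "exact (node D i One) (node D i Two) (node D i Three) (row_kf D i) (row_qf D i)"
  using assms short_exact_iff[of "row_k D i" "node D i One" "node D i Two" "row_q D i" "node D i Three"]
  by (simp add: three_by_three_def)

lemma col_exact:
  assumes "D \<in> \<D> K Q"
  shows "exact (node D One j) (node D Two j) (node D Three j) (col_kf D j) (col_qf D j)"
  using row_exact[OF transpose_three_by_three[OF assms]] by simp

lemma row_hom:
  assumes "D \<in> \<D> K Q"
  shows "row_k D i \<in> hom \<C> (node D i One) (node D i Two)"
    "row_q D i \<in> hom \<C> (node D i Two) (node D i Three)"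
  using assms by (simp_all add: three_by_three_def)

lemma col_hom:
  assumes "D \<in> \<D> K Q"
  shows "col_k D j \<in> hom \<C> (node D One j) (node D Two j)"
    "col_q D j \<in> hom \<C> (node D Two j) (node D Three j)"
  using assms by (simp_all add: three_by_three_def)

lemmas row_morph = hom_morph[OF row_hom(1)] hom_morph[OF row_hom(2)]
lemmas col_morph = hom_morph[OF col_hom(1)] hom_morph[OF col_hom(2)]

lemma square_kk:
  assumes D: "D \<in> \<D> K Q" and x: "x \<in> U K"
  shows "row_kf D Two (col_kf D One x) = into D x"
proof -
  have "col_k D Two \<cdot>\<^bsub>\<C>\<^esub> row_k D One = row_k D Two \<cdot>\<^bsub>\<C>\<^esub> col_k D One"
    using D by (simp add: three_by_three_def)
  from comp_eqD[OF this row_hom(1)[OF D] col_hom(1)[OF D], of x] show ?thesis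
    using x diagram_corners[OF D] by (simp add: into_def)
qed

lemma square_kq:
  assumes D: "D \<in> \<D> K Q" and x: "x \<in> U (node D Two One)"
  shows "col_qf D Two (row_kf D Two x) = row_kf D Three (col_qf D One x)"
proof -
  have "col_q D Two \<cdot>\<^bsub>\<C>\<^esub> row_k D Two = row_k D Three \<cdot>\<^bsub>\<C>\<^esub> col_q D One"
    using D by (simp add: three_by_three_def)
  from comp_eqD[OF this row_hom(1)[OF D] col_hom(2)[OF D] x] show ?thesis .
qed

lemma square_qk:
  assumes D: "D \<in> \<D> K Q" and x: "x \<in> U (node D One Two)"
  shows "row_qf D Two (col_kf D Two x) = col_kf D Three (row_qf D One x)"
  using square_kq[OF transpose_three_by_three[OF D], of x] x by simp

lemma square_qq:
  assumes D: "D \<in> \<D> K Q" and y: "y \<in> U (Y D)"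
  shows "col_qf D Three (row_qf D Two y) = out D y"
proof -
  have "col_q D Three \<cdot>\<^bsub>\<C>\<^esub> row_q D Two = row_q D Three \<cdot>\<^bsub>\<C>\<^esub> col_q D Two"
    using D by (simp add: three_by_three_def)
  from comp_eqD[OF this row_hom(2)[OF D] col_hom(2)[OF D] y] show ?thesis
    by (simp add: out_def)
qed

lemma into_transpose: "D \<in> \<D> K Q \<Longrightarrow> x \<in> U K \<Longrightarrow> into (transpose D) x = into D x"
  using square_kk by (simp add: into_def[of "transpose D"])

lemma out_transpose: "D \<in> \<D> K Q \<Longrightarrow> y \<in> U (Y D) \<Longrightarrow> out (transpose D) y = out D y"
  using square_qq by (simp add: out_def[of "transpose D"])

lemma morph_into: "D \<in> \<D> K Q \<Longrightarrow> morph K (Y D) (into D)"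
  using morph_comp[OF row_morph(1)[of D K Q One] col_morph(1)[of D K Q Two]] diagram_corners[of D K Q]
  by (simp add: into_def[abs_def])

lemma morph_out: "D \<in> \<D> K Q \<Longrightarrow> morph (Y D) Q (out D)"
  using morph_comp[OF col_morph(2)[of D K Q Two] row_morph(2)[of D K Q Three]] diagram_corners[of D K Q]
  by (simp add: out_def[abs_def])

lemma out_surj:
  assumes D: "D \<in> \<D> K Q" and z: "z \<in> U Q"
  shows "\<exists>y\<in>U (Y D). out D y = z"
proof -
  have "row_qf D Three ` U (node D Three Two) = U Q" "col_qf D Two ` U (Y D) = U (node D Three Two)"
    using row_exact[OF D, of Three] col_exact[OF D, of Two] diagram_corners[OF D]
    by (simp_all add: exact_def)
  then have "z \<in> row_qf D Three ` col_qf D Two ` U (Y D)" using z by simp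
  then show ?thesis unfolding out_def by blast
qed

text \<open>
  If \<open>y\<close> lies over zero, its image in the middle of the bottom row lies in the kernel of the map
  to \<open>Q\<close>, so it comes from the lower left corner, and then from the kernel of the middle row because the
  first column ends in a surjection.
\<close>

lemma out_zero_lift:
  assumes D: "D \<in> \<D> K Q" and y: "y \<in> U (Y D)" and zero: "out D y = zero Q"
  shows "\<exists>m\<in>U (Y D). row_qf D Two m = zero (node D Two Three) \<and> col_qf D Two m = col_qf D Two y"
proof -
  have im3: "row_kf D Three ` U (node D Three One) =
      {w \<in> U (node D Three Two). row_qf D Three w = zero Q}"
    using row_exact[OF D, of Three] diagram_corners[OF D] by (simp add: exact_def)
  have im2: "row_kf D Two ` U (node D Two One) =
      {w \<in> U (Y D). row_qf D Two w = zero (node D Two Three)}"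
    using row_exact[OF D, of Two] by (simp add: exact_def)
  have onto: "col_qf D One ` U (node D Two One) = U (node D Three One)"
    using col_exact[OF D, of One] by (simp add: exact_def)
  have "col_qf D Two y \<in> row_kf D Three ` U (node D Three One)"
    unfolding im3 using zero morph_in[OF col_morph(2)[OF D] y] by (simp add: out_def)
  then obtain x where x: "x \<in> U (node D Two One)" "col_qf D Two y = row_kf D Three (col_qf D One x)"
    unfolding onto[symmetric] by blast
  have "row_kf D Two x \<in> {w \<in> U (Y D). row_qf D Two w = zero (node D Two Three)}"
    unfolding im2[symmetric] using x(1) by blast
  then show ?thesis using square_kq[OF D x(1)] x(2) by force
qed


subsection \<open>Morphisms are determined in the middle\<close>

text \<open>
  The components below the diagonal: \<open>t21\<close> is induced on kernels, \<open>t32\<close> on cokernels, and \<open>t31\<close> on the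
  cokernels of the first column.  The remaining squares commute because maps that are
  injective, respectively surjective, can be cancelled.
\<close>

lemma lower_components:
  assumes D: "D \<in> \<D> K Q" and E: "E \<in> \<D> K Q" and h: "morph (Y D) (Y E) h"
    and h_into: "\<And>x. x \<in> U K \<Longrightarrow> h (into D x) = into E x"
    and h_out: "\<And>y. y \<in> U (Y D) \<Longrightarrow> out E (h y) = out D y"
    and h_row: "\<And>y. y \<in> U (Y D) \<Longrightarrow> row_qf D Two y = zero (node D Two Three) \<Longrightarrow>
        row_qf E Two (h y) = zero (node E Two Three)"
    and h_col: "\<And>y. y \<in> U (Y D) \<Longrightarrow> col_qf D Two y = zero (node D Three Two) \<Longrightarrow>
        col_qf E Two (h y) = zero (node E Three Two)"
  obtains t21 t31 t32 where
    "morph (node D Two One) (node E Two One) t21"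
    "morph (node D Three One) (node E Three One) t31"
    "morph (node D Three Two) (node E Three Two) t32"
    "\<And>x. x \<in> U (node D Two One) \<Longrightarrow> row_kf E Two (t21 x) = h (row_kf D Two x)"
    "\<And>x. x \<in> U K \<Longrightarrow> t21 (col_kf D One x) = col_kf E One x"
    "\<And>x. x \<in> U (node D Two One) \<Longrightarrow> t31 (col_qf D One x) = col_qf E One (t21 x)"
    "\<And>y. y \<in> U (Y D) \<Longrightarrow> t32 (col_qf D Two y) = col_qf E Two (h y)"
    "\<And>z. z \<in> U (node D Three One) \<Longrightarrow> t32 (row_kf D Three z) = row_kf E Three (t31 z)"
    "\<And>w. w \<in> U (node D Three Two) \<Longrightarrow> row_qf E Three (t32 w) = row_qf D Three w"
proof -
  note D11 = diagram_corners(1)[OF D] and E11 = diagram_corners(1)[OF E]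
  have "row_qf E Two (h (row_kf D Two x)) = zero (node E Two Three)" if x: "x \<in> U (node D Two One)" for x
  proof (rule h_row)
    show "row_kf D Two x \<in> U (Y D)" by (rule morph_in[OF row_morph(1)[OF D] x])
    show "row_qf D Two (row_kf D Two x) = zero (node D Two Three)"
      using row_exact[OF D, of Two] x by (auto simp: exact_def)
  qed
  then obtain t21 where t21: "morph (node D Two One) (node E Two One) t21"
      "\<And>x. x \<in> U (node D Two One) \<Longrightarrow> row_kf E Two (t21 x) = h (row_kf D Two x)"
    using exact_factor_kernel[OF row_exact[OF E] morph_comp[OF row_morph(1)[OF D] h]] by blast
  have t21_k: "t21 (col_kf D One x) = col_kf E One x" if x: "x \<in> U K" for x
  proof -
    have Dx: "col_kf D One x \<in> U (node D Two One)"
      using morph_in[OF col_morph(1)[OF D, of One]] x D11 by simp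
    have Ex: "col_kf E One x \<in> U (node E Two One)"
      using morph_in[OF col_morph(1)[OF E, of One]] x E11 by simp
    have "row_kf E Two (t21 (col_kf D One x)) = row_kf E Two (col_kf E One x)"
      using t21(2)[OF Dx] square_kk[OF D x] square_kk[OF E x] h_into[OF x] by simp
    moreover have "inj_on (row_kf E Two) (U (node E Two One))"
      using row_exact[OF E, of Two] by (simp add: exact_def)
    ultimately show ?thesis
      using morph_in[OF t21(1) Dx] Ex by (simp add: inj_on_eq_iff)
  qed
  have "col_qf E One (t21 (col_kf D One x)) = zero (node E Three One)" if x: "x \<in> U (node D One One)" for x
  proof -
    have "x \<in> U K" using x D11 by simp
    then show ?thesis
      using t21_k col_exact[OF E, of One] E11 by (auto simp: exact_def)
  qed
  then obtain t31 where t31: "morph (node D Three One) (node E Three One) t31"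
      "\<And>x. x \<in> U (node D Two One) \<Longrightarrow> t31 (col_qf D One x) = col_qf E One (t21 x)"
    using exact_factor_cokernel[OF col_exact[OF D] morph_comp[OF t21(1) col_morph(2)[OF E]]] by blast
  have "col_qf E Two (h (col_kf D Two x)) = zero (node E Three Two)" if x: "x \<in> U (node D One Two)" for x
  proof (rule h_col)
    show "col_kf D Two x \<in> U (Y D)" by (rule morph_in[OF col_morph(1)[OF D] x])
    show "col_qf D Two (col_kf D Two x) = zero (node D Three Two)"
      using col_exact[OF D, of Two] x by (auto simp: exact_def)
  qed
  then obtain t32 where t32: "morph (node D Three Two) (node E Three Two) t32"
      "\<And>y. y \<in> U (Y D) \<Longrightarrow> t32 (col_qf D Two y) = col_qf E Two (h y)"
    using exact_factor_cokernel[OF col_exact[OF D] morph_comp[OF h col_morph(2)[OF E]]] by blast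
  have t32_k: "t32 (row_kf D Three z) = row_kf E Three (t31 z)" if z: "z \<in> U (node D Three One)" for z
  proof -
    have "z \<in> col_qf D One ` U (node D Two One)"
      using z col_exact[OF D, of One] by (simp add: exact_def)
    then obtain x where x: "x \<in> U (node D Two One)" "z = col_qf D One x" by blast
    have "t32 (row_kf D Three z) = col_qf E Two (h (row_kf D Two x))"
      using square_kq[OF D x(1)] x(2) t32(2)[OF morph_in[OF row_morph(1)[OF D] x(1)]] by simp
    also have "\<dots> = col_qf E Two (row_kf E Two (t21 x))" using t21(2)[OF x(1)] by simp
    also have "\<dots> = row_kf E Three (t31 z)"
      using square_kq[OF E morph_in[OF t21(1) x(1)]] t31(2)[OF x(1)] x(2) by simp
    finally show ?thesis .
  qed
  have t32_q: "row_qf E Three (t32 w) = row_qf D Three w" if w: "w \<in> U (node D Three Two)" for w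
  proof -
    have "w \<in> col_qf D Two ` U (Y D)"
      using w col_exact[OF D, of Two] by (simp add: exact_def)
    then obtain y where y: "y \<in> U (Y D)" "w = col_qf D Two y" by blast
    show ?thesis using t32(2)[OF y(1)] h_out[OF y(1)] y(2) by (simp add: out_def)
  qed
  show ?thesis by (rule that[OF t21(1) t31(1) t32(1) t21(2) t21_k t31(2) t32(2) t32_k t32_q])
qed

lemma diagram_morphism_of_functions:
  assumes D: "D \<in> \<D> K Q" and E: "E \<in> \<D> K Q"
    and \<tau>: "\<And>i j. morph (node D i j) (node E i j) (\<tau> i j)"
    and rk: "\<And>i x. x \<in> U (node D i One) \<Longrightarrow> \<tau> i Two (row_kf D i x) = row_kf E i (\<tau> i One x)"
    and rq: "\<And>i x. x \<in> U (node D i Two) \<Longrightarrow> \<tau> i Three (row_qf D i x) = row_qf E i (\<tau> i Two x)"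
    and ck: "\<And>j x. x \<in> U (node D One j) \<Longrightarrow> \<tau> Two j (col_kf D j x) = col_kf E j (\<tau> One j x)"
    and cq: "\<And>j x. x \<in> U (node D Two j) \<Longrightarrow> \<tau> Three j (col_qf D j x) = col_qf E j (\<tau> Two j x)"
  shows "diagram_morphism \<C> D E (\<lambda>i j. arrow (node D i j) (node E i j) (\<tau> i j))"
proof -
  note \<theta> = arrow_hom[OF \<tau>]
  note D_in = morph_in[OF row_morph(1)[OF D]] morph_in[OF row_morph(2)[OF D]]
    morph_in[OF col_morph(1)[OF D]] morph_in[OF col_morph(2)[OF D]]
  show ?thesis
    unfolding diagram_morphism_def
  proof (intro conjI allI)
    fix i j
    show "arrow (node D i j) (node E i j) (\<tau> i j) \<in> hom \<C> (node D i j) (node E i j)" by (rule \<theta>)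
    show "arrow (node D i Two) (node E i Two) (\<tau> i Two) \<cdot>\<^bsub>\<C>\<^esub> row_k D i =
        row_k E i \<cdot>\<^bsub>\<C>\<^esub> arrow (node D i One) (node E i One) (\<tau> i One)"
      by (rule comp_eqI[OF row_hom(1)[OF D] \<theta> \<theta> row_hom(1)[OF E]]) (simp add: D_in rk)
    show "arrow (node D i Three) (node E i Three) (\<tau> i Three) \<cdot>\<^bsub>\<C>\<^esub> row_q D i =
        row_q E i \<cdot>\<^bsub>\<C>\<^esub> arrow (node D i Two) (node E i Two) (\<tau> i Two)"
      by (rule comp_eqI[OF row_hom(2)[OF D] \<theta> \<theta> row_hom(2)[OF E]]) (simp add: D_in rq)
    show "arrow (node D Two j) (node E Two j) (\<tau> Two j) \<cdot>\<^bsub>\<C>\<^esub> col_k D j =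
        col_k E j \<cdot>\<^bsub>\<C>\<^esub> arrow (node D One j) (node E One j) (\<tau> One j)"
      by (rule comp_eqI[OF col_hom(1)[OF D] \<theta> \<theta> col_hom(1)[OF E]]) (simp add: D_in ck)
    show "arrow (node D Three j) (node E Three j) (\<tau> Three j) \<cdot>\<^bsub>\<C>\<^esub> col_q D j =
        col_q E j \<cdot>\<^bsub>\<C>\<^esub> arrow (node D Two j) (node E Two j) (\<tau> Two j)"
      by (rule comp_eqI[OF col_hom(2)[OF D] \<theta> \<theta> col_hom(2)[OF E]]) (simp add: D_in cq)
  qed
qed

text \<open>
  Transposing the diagrams turns the components below the diagonal into those above it.
\<close>

lemma diagram_step_from_middle:
  assumes D: "D \<in> \<D> K Q" and E: "E \<in> \<D> K Q" and h: "morph (Y D) (Y E) h"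
    and h_into: "\<And>x. x \<in> U K \<Longrightarrow> h (into D x) = into E x"
    and h_out: "\<And>y. y \<in> U (Y D) \<Longrightarrow> out E (h y) = out D y"
    and h_row: "\<And>y. y \<in> U (Y D) \<Longrightarrow> row_qf D Two y = zero (node D Two Three) \<Longrightarrow>
        row_qf E Two (h y) = zero (node E Two Three)"
    and h_col: "\<And>y. y \<in> U (Y D) \<Longrightarrow> col_qf D Two y = zero (node D Three Two) \<Longrightarrow>
        col_qf E Two (h y) = zero (node E Three Two)"
  shows "(D, E) \<in> diagram_step \<C> K Q"
proof -
  note corners = diagram_corners[OF D] diagram_corners[OF E]
  note D' = transpose_three_by_three[OF D] and E' = transpose_three_by_three[OF E]
  obtain t21 t31 t32 where lower:
    "morph (node D Two One) (node E Two One) t21"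
    "morph (node D Three One) (node E Three One) t31"
    "morph (node D Three Two) (node E Three Two) t32"
    "\<And>x. x \<in> U (node D Two One) \<Longrightarrow> row_kf E Two (t21 x) = h (row_kf D Two x)"
    "\<And>x. x \<in> U K \<Longrightarrow> t21 (col_kf D One x) = col_kf E One x"
    "\<And>x. x \<in> U (node D Two One) \<Longrightarrow> t31 (col_qf D One x) = col_qf E One (t21 x)"
    "\<And>y. y \<in> U (Y D) \<Longrightarrow> t32 (col_qf D Two y) = col_qf E Two (h y)"
    "\<And>z. z \<in> U (node D Three One) \<Longrightarrow> t32 (row_kf D Three z) = row_kf E Three (t31 z)"
    "\<And>w. w \<in> U (node D Three Two) \<Longrightarrow> row_qf E Three (t32 w) = row_qf D Three w"
    using lower_components[OF D E h h_into h_out h_row h_col] by blast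
  have Y': "morph (Y (transpose D)) (Y (transpose E)) h" using h by simp
  obtain t12 t13 t23 where upper:
    "morph (node D One Two) (node E One Two) t12"
    "morph (node D One Three) (node E One Three) t13"
    "morph (node D Two Three) (node E Two Three) t23"
    "\<And>x. x \<in> U (node D One Two) \<Longrightarrow> col_kf E Two (t12 x) = h (col_kf D Two x)"
    "\<And>x. x \<in> U K \<Longrightarrow> t12 (row_kf D One x) = row_kf E One x"
    "\<And>x. x \<in> U (node D One Two) \<Longrightarrow> t13 (row_qf D One x) = row_qf E One (t12 x)"
    "\<And>y. y \<in> U (Y D) \<Longrightarrow> t23 (row_qf D Two y) = row_qf E Two (h y)"
    "\<And>z. z \<in> U (node D One Three) \<Longrightarrow> t23 (col_kf D Three z) = col_kf E Three (t13 z)"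
    "\<And>w. w \<in> U (node D Two Three) \<Longrightarrow> col_qf E Three (t23 w) = col_qf D Three w"
  proof (rule lower_components[OF D' E' Y'])
    show "h (into (transpose D) x) = into (transpose E) x" if "x \<in> U K" for x
      using that h_into into_transpose[OF D] into_transpose[OF E] by simp
    show "out (transpose E) (h y) = out (transpose D) y" if "y \<in> U (Y (transpose D))" for y
      using that h_out out_transpose[OF D] out_transpose[OF E] morph_in[OF h] by simp
  qed (use h_row h_col in simp_all)
  define \<tau> where "\<tau> = case_three (case_three (\<lambda>x. x) t12 t13) (case_three t21 h t23)
    (case_three t31 t32 (\<lambda>x. x))"
  have KQ: "K \<in> Alg" "Q \<in> Alg"
    using morph_Alg[OF morph_into[OF D]] morph_Alg[OF morph_out[OF D]] by simp_all
  have "morph (node D i j) (node E i j) (\<tau> i j)" for i j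
    using lower upper h KQ corners
    by (cases i; cases j) (simp_all add: \<tau>_def morph_id)
  moreover have "\<tau> i Two (row_kf D i x) = row_kf E i (\<tau> i One x)" if "x \<in> U (node D i One)" for i x
    using that lower upper corners by (cases i) (simp_all add: \<tau>_def)
  moreover have "\<tau> i Three (row_qf D i x) = row_qf E i (\<tau> i Two x)" if "x \<in> U (node D i Two)" for i x
    using that lower upper corners by (cases i) (simp_all add: \<tau>_def)
  moreover have "\<tau> Two j (col_kf D j x) = col_kf E j (\<tau> One j x)" if "x \<in> U (node D One j)" for j x
    using that lower upper corners by (cases j) (simp_all add: \<tau>_def)
  moreover have "\<tau> Three j (col_qf D j x) = col_qf E j (\<tau> Two j x)" if "x \<in> U (node D Two j)" for j x
    using that lower upper corners by (cases j) (simp_all add: \<tau>_def)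
  ultimately have "diagram_morphism \<C> D E (\<lambda>i j. arrow (node D i j) (node E i j) (\<tau> i j))"
    by (rule diagram_morphism_of_functions[OF D E])
  moreover have "arrow (node D One One) (node E One One) (\<tau> One One) = Ident \<C> K"
    "arrow (node D Three Three) (node E Three Three) (\<tau> Three Three) = Ident \<C> Q"
    by (simp_all add: \<tau>_def corners Ident_arrow)
  ultimately show ?thesis
    unfolding diagram_step_def using D E by blast
qed


subsection \<open>Subdiagrams\<close>

lemma exact_cong:
  assumes "exact A B D k q" "\<And>x. x \<in> U A \<Longrightarrow> k' x = k x" "\<And>y. y \<in> U B \<Longrightarrow> q' y = q y"
  shows "exact A B D k' q'"
proof -
  have "morph A B k'" "morph B D q'"
    using assms morph_cong[of A B k k'] morph_cong[of B D q q'] by (simp_all add: exact_def)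
  moreover have "inj_on k' (U A)"
    using assms inj_on_cong[of "U A" k' k] by (simp add: exact_def)
  moreover have "k' ` U A = k ` U A" "q' ` U B = q ` U B"
    using assms(2,3) by (simp_all cong: image_cong)
  moreover have "{y \<in> U B. q' y = zero D} = {y \<in> U B. q y = zero D}"
    using assms(3) by auto
  ultimately show ?thesis using assms(1) by (simp add: exact_def)
qed

text \<open>
  Cutting the left algebra down to the full preimage keeps exactness in the middle; cutting the right
  one down to the image keeps the second map onto.
\<close>

lemma exact_restrict:
  assumes ex: "exact A B D k q" and S: "closed A S" and T: "closed B T" and R: "closed D R"
    and S_eq: "S = {x \<in> U A. k x \<in> T}" and R_eq: "R = q ` T"
  shows "exact (sub A S) (sub B T) (sub D R) k q"
proof -
  have k: "morph A B k" and q: "morph B D q" and inj: "inj_on k (U A)"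
    and im: "k ` U A = {y \<in> U B. q y = zero D}"
    using ex by (simp_all add: exact_def)
  have "morph (sub A S) (sub B T) k"
    by (rule morph_restrict[OF S T k]) (simp add: S_eq)
  moreover have "morph (sub B T) (sub D R) q"
    by (rule morph_restrict[OF T R q]) (simp add: R_eq)
  moreover have "inj_on k S"
    using inj by (rule inj_on_subset) (auto simp: S_eq)
  moreover have "k ` S = {y \<in> T. q y = zero D}"
  proof
    show "k ` S \<subseteq> {y \<in> T. q y = zero D}" using im S_eq by blast
    show "{y \<in> T. q y = zero D} \<subseteq> k ` S"
    proof
      fix y assume y: "y \<in> {y \<in> T. q y = zero D}"
      then have "y \<in> k ` U A" unfolding im using closed_subset[OF T] by auto
      then show "y \<in> k ` S" using y S_eq by auto
    qed
  qed
  ultimately show ?thesis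
    using S T R R_eq by (simp add: exact_def zero_sub)
qed

text \<open>
  The conditions on a subalgebra \<open>S\<close> of the middle object under which intersecting \<open>S\<close> with
  the kernels and taking its images in the quotients produces a three by three diagram again.
  The last one provides the liftings that keep the bottom row and the last column exact.
\<close>

definition spanning :: "('u algebra, 'u homomorphism) diagram \<Rightarrow> 'u set \<Rightarrow> bool" where
  "spanning D S \<longleftrightarrow> closed (Y D) S \<and>
     (\<forall>x\<in>U (node D One One). into D x \<in> S) \<and>
     (\<forall>z\<in>U (node D Three Three). \<exists>y\<in>S. out D y = z) \<and>
     (\<forall>y\<in>S. out D y = zero (node D Three Three) \<longrightarrow>
        (\<exists>m\<in>S. row_qf D Two m = zero (node D Two Three) \<and> col_qf D Two m = col_qf D Two y) \<and>
        (\<exists>n\<in>S. col_qf D Two n = zero (node D Three Two) \<and> row_qf D Two n = row_qf D Two y))"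

definition part :: "('u algebra, 'u homomorphism) diagram \<Rightarrow> 'u set \<Rightarrow> three \<Rightarrow> three \<Rightarrow> 'u set" where
  "part D S i j =
    (let N = {x \<in> U (node D One Two). col_kf D Two x \<in> S};
         M = {x \<in> U (node D Two One). row_kf D Two x \<in> S}
     in case_three
       (case_three (U (node D One One)) N (row_qf D One ` N))
       (case_three M S (row_qf D Two ` S))
       (case_three (col_qf D One ` M) (col_qf D Two ` S) (U (node D Three Three))) i j)"

definition restriction ::
  "('u algebra, 'u homomorphism) diagram \<Rightarrow> 'u set \<Rightarrow> ('u algebra, 'u homomorphism) diagram" where
  "restriction D S = (let N = (\<lambda>i j. sub (node D i j) (part D S i j)) in
     \<lparr>node = N,
      row_k = (\<lambda>i. arrow (N i One) (N i Two) (row_kf D i)),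
      row_q = (\<lambda>i. arrow (N i Two) (N i Three) (row_qf D i)),
      col_k = (\<lambda>j. arrow (N One j) (N Two j) (col_kf D j)),
      col_q = (\<lambda>j. arrow (N Two j) (N Three j) (col_qf D j))\<rparr>)"

lemma restriction_sel [simp]:
  "node (restriction D S) i j = sub (node D i j) (part D S i j)"
  "row_k (restriction D S) i =
    arrow (sub (node D i One) (part D S i One)) (sub (node D i Two) (part D S i Two)) (row_kf D i)"
  "row_q (restriction D S) i =
    arrow (sub (node D i Two) (part D S i Two)) (sub (node D i Three) (part D S i Three)) (row_qf D i)"
  "col_k (restriction D S) j =
    arrow (sub (node D One j) (part D S One j)) (sub (node D Two j) (part D S Two j)) (col_kf D j)"
  "col_q (restriction D S) j =
    arrow (sub (node D Two j) (part D S Two j)) (sub (node D Three j) (part D S Three j)) (col_qf D j)"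
  by (simp_all add: restriction_def)

lemma spanning_transpose:
  assumes D: "D \<in> \<D> K Q" and S: "spanning D S"
  shows "spanning (transpose D) S"
proof -
  have "S \<subseteq> U (Y D)" using S by (simp add: spanning_def closed_def)
  then have "out (transpose D) y = out D y" if "y \<in> S" for y
    using that out_transpose[OF D] by blast
  moreover have "into (transpose D) x = into D x" if "x \<in> U (node D One One)" for x
    using that into_transpose[OF D] diagram_corners[OF D] by simp
  ultimately show ?thesis
    using S by (simp add: spanning_def)
qed

lemma part_transpose: "part (transpose D) S i j = part D S j i"
  by (cases i; cases j) (simp_all add: part_def)

lemma closed_part:
  assumes D: "D \<in> \<D> K Q" and S: "spanning D S"
  shows "closed (node D i j) (part D S i j)"
proof -
  have Y: "closed (Y D) S" using S by (simp add: spanning_def)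
  have N: "closed (node D One Two) {x \<in> U (node D One Two). col_kf D Two x \<in> S}"
    by (rule closed_vimage[OF Y col_morph(1)[OF D]])
  have M: "closed (node D Two One) {x \<in> U (node D Two One). row_kf D Two x \<in> S}"
    by (rule closed_vimage[OF Y row_morph(1)[OF D]])
  have node: "node D i j \<in> Alg" for i j
    using D by (simp add: three_by_three_def)
  show ?thesis
    using Y N M closed_image[OF N row_morph(2)[OF D]] closed_image[OF M col_morph(2)[OF D]]
      closed_image[OF Y row_morph(2)[OF D]] closed_image[OF Y col_morph(2)[OF D]]
      closed_full[OF node]
    by (cases i; cases j) (simp_all add: part_def)
qed

lemma restriction_row_exact:
  assumes D: "D \<in> \<D> K Q" and S: "spanning D S"
  shows "exact (sub (node D i One) (part D S i One)) (sub (node D i Two) (part D S i Two))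
    (sub (node D i Three) (part D S i Three)) (row_kf D i) (row_qf D i)"
proof (rule exact_restrict[OF row_exact[OF D] closed_part[OF D S] closed_part[OF D S] closed_part[OF D S]])
  note corners = diagram_corners[OF D]
  have S_sub: "S \<subseteq> U (Y D)" using S by (simp add: spanning_def closed_def)
  have k_in: "row_kf D One x \<in> U (node D One Two)" if "x \<in> U (node D One One)" for x
    by (rule morph_in[OF row_morph(1)[OF D] that])
  have into: "col_kf D Two (row_kf D One x) \<in> S" if "x \<in> U (node D One One)" for x
    using S that by (simp add: spanning_def into_def)
  \<comment> \<open>In the bottom row the left object is cut down to an image; by the lifting condition on \<open>S\<close> this
    is the full preimage that restricting an exact sequence requires.\<close>
  have bottom: "col_qf D One ` {x \<in> U (node D Two One). row_kf D Two x \<in> S} =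
      {z \<in> U (node D Three One). row_kf D Three z \<in> col_qf D Two ` S}" (is "?l = ?r")
  proof
    show "?l \<subseteq> ?r"
      using square_kq[OF D] morph_in[OF col_morph(2)[OF D, of One]] by (auto simp: image_iff) metis
    show "?r \<subseteq> ?l"
    proof
      fix z assume "z \<in> ?r"
      then obtain y where z: "z \<in> U (node D Three One)" and y: "y \<in> S" "row_kf D Three z = col_qf D Two y"
        by auto
      have "row_kf D Three z \<in> {w \<in> U (node D Three Two). row_qf D Three w = zero Q}"
        using row_exact[OF D, of Three] z corners by (auto simp: exact_def)
      then have "out D y = zero Q" using y(2) by (simp add: out_def)
      then obtain m where m: "m \<in> S" "row_qf D Two m = zero (node D Two Three)"
          "col_qf D Two m = col_qf D Two y"
        using S y(1) corners by (auto simp: spanning_def)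
      have "m \<in> row_kf D Two ` U (node D Two One)"
        using row_exact[OF D, of Two] m(1,2) S_sub by (auto simp: exact_def)
      then obtain x where x: "x \<in> U (node D Two One)" "m = row_kf D Two x" by blast
      have "row_kf D Three (col_qf D One x) = row_kf D Three z"
        using square_kq[OF D x(1)] x(2) m(3) y(2) by simp
      moreover have "inj_on (row_kf D Three) (U (node D Three One))"
        using row_exact[OF D, of Three] by (simp add: exact_def)
      ultimately have "col_qf D One x = z"
        using morph_in[OF col_morph(2)[OF D] x(1)] z by (simp add: inj_on_eq_iff)
      then show "z \<in> ?l" using x m(1) by blast
    qed
  qed
  show "part D S i One = {x \<in> U (node D i One). row_kf D i x \<in> part D S i Two}"
    using k_in into bottom by (cases i) (auto simp: part_def)
  have "U Q \<subseteq> row_qf D Three ` col_qf D Two ` S"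
    using S corners by (force simp: spanning_def out_def)
  moreover have "row_qf D Three ` col_qf D Two ` S \<subseteq> U Q"
    using S_sub morph_in[OF morph_out[OF D]] by (auto simp: out_def)
  ultimately show "part D S i Three = row_qf D i ` part D S i Two"
    using corners by (cases i) (simp_all add: part_def)
qed

lemma restriction_col_exact:
  assumes D: "D \<in> \<D> K Q" and S: "spanning D S"
  shows "exact (sub (node D One j) (part D S One j)) (sub (node D Two j) (part D S Two j))
    (sub (node D Three j) (part D S Three j)) (col_kf D j) (col_qf D j)"
  using restriction_row_exact[OF transpose_three_by_three[OF D] spanning_transpose[OF D S], of j]
  by (simp add: part_transpose)

lemma restriction_three_by_three:
  assumes D: "D \<in> \<D> K Q" and S: "spanning D S"
  shows "restriction D S \<in> \<D> K Q"
proof -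
  let ?R = "restriction D S"
  let ?n = "\<lambda>i j. sub (node D i j) (part D S i j)"
  have U: "U (?n i j) = part D S i j" for i j
    by (rule U_sub_closed[OF closed_part[OF D S]])
  have in_D: "x \<in> U (node D i j)" if "x \<in> part D S i j" for x i j
    using that closed_subset[OF closed_part[OF D S]] by blast
  have m: "morph (?n i One) (?n i Two) (row_kf D i)" "morph (?n i Two) (?n i Three) (row_qf D i)"
    "morph (?n One j) (?n Two j) (col_kf D j)" "morph (?n Two j) (?n Three j) (col_qf D j)" for i j
    using restriction_row_exact[OF D S, of i] restriction_col_exact[OF D S, of j]
    by (simp_all add: exact_def)
  note h = m[THEN arrow_hom]
  have node: "node ?R i j \<in> Obj \<C>" for i j
    using sub_Alg[OF closed_part[OF D S]] by simp
  have corners: "node ?R One One = K" "node ?R Three Three = Q"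
  proof -
    have "K \<in> Alg" "Q \<in> Alg"
      using morph_Alg[OF morph_into[OF D]] morph_Alg[OF morph_out[OF D]] by simp_all
    then show "node ?R One One = K" "node ?R Three Three = Q"
      using diagram_corners[OF D] by (simp_all add: part_def sub_full)
  qed
  have rows: "row_k ?R i \<in> hom \<C> (node ?R i One) (node ?R i Two) \<and>
      row_q ?R i \<in> hom \<C> (node ?R i Two) (node ?R i Three) \<and>
      short_exact \<C> (row_k ?R i) (row_q ?R i)" for i
  proof -
    have "exact (?n i One) (?n i Two) (?n i Three) (row_kf ?R i) (row_qf ?R i)"
      by (rule exact_cong[OF restriction_row_exact[OF D S]]) simp_all
    then show ?thesis using h short_exact_iff[OF h(1) h(2)] by simp
  qed
  have cols: "col_k ?R j \<in> hom \<C> (node ?R One j) (node ?R Two j) \<and>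
      col_q ?R j \<in> hom \<C> (node ?R Two j) (node ?R Three j) \<and>
      short_exact \<C> (col_k ?R j) (col_q ?R j)" for j
  proof -
    have "exact (?n One j) (?n Two j) (?n Three j) (col_kf ?R j) (col_qf ?R j)"
      by (rule exact_cong[OF restriction_col_exact[OF D S]]) simp_all
    then show ?thesis using h short_exact_iff[OF h(3) h(4)] by simp
  qed
  note into_part = m[THEN morph_in, unfolded U]
  have kk: "row_kf D Two (col_kf D One x) = col_kf D Two (row_kf D One x)"
    if "x \<in> part D S One One" for x
    using square_kk[OF D, of x] in_D[OF that] diagram_corners[OF D] by (simp add: into_def)
  have "col_k ?R Two \<cdot>\<^bsub>\<C>\<^esub> row_k ?R One = row_k ?R Two \<cdot>\<^bsub>\<C>\<^esub> col_k ?R One"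
    unfolding restriction_sel
    by (rule comp_eqI[OF h(1) h(3) h(3) h(1)])
      (use into_part kk in \<open>simp add: U\<close>)
  moreover have "col_k ?R Three \<cdot>\<^bsub>\<C>\<^esub> row_q ?R One = row_q ?R Two \<cdot>\<^bsub>\<C>\<^esub> col_k ?R Two"
    unfolding restriction_sel
    by (rule comp_eqI[OF h(2) h(3) h(3) h(2)])
      (use into_part in_D square_qk[OF D] in \<open>simp add: U\<close>)
  moreover have "col_q ?R Two \<cdot>\<^bsub>\<C>\<^esub> row_k ?R Two = row_k ?R Three \<cdot>\<^bsub>\<C>\<^esub> col_q ?R One"
    unfolding restriction_sel
    by (rule comp_eqI[OF h(1) h(4) h(4) h(1)])
      (use into_part in_D square_kq[OF D] in \<open>simp add: U\<close>)
  moreover have "col_q ?R Three \<cdot>\<^bsub>\<C>\<^esub> row_q ?R Two = row_q ?R Three \<cdot>\<^bsub>\<C>\<^esub> col_q ?R Two"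
    unfolding restriction_sel
    by (rule comp_eqI[OF h(2) h(4) h(4) h(2)])
      (use into_part in_D square_qq[OF D] in \<open>simp add: U out_def\<close>)
  ultimately show ?thesis
    unfolding three_by_three_def using node corners rows cols by blast
qed

end


section \<open>Skolem terms\<close>

text \<open>
  Names for elements of the middle object: images of elements of \<open>K\<close>, chosen preimages of elements of
  \<open>Q\<close>, values of operations, liftings into the kernels of the middle row and of the middle column,
  and the chosen preimage of the image in \<open>Q\<close>.
\<close>

datatype 'u skolem =
    From_K 'u
  | Over_Q 'u
  | Apply 'u "'u skolem list"
  | Row_Lift "'u skolem"
  | Col_Lift "'u skolem"
  | Same_Base "'u skolem"

context semi_abelian_variety
begin

text \<open>
  Stratification by depth makes smallness an induction; every term has a finite depth because the
  operations are finitary.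
\<close>

primrec terms_to_depth :: "'u algebra \<Rightarrow> 'u algebra \<Rightarrow> nat \<Rightarrow> 'u skolem set" where
  "terms_to_depth K Q 0 = From_K ` U K \<union> Over_Q ` U Q"
| "terms_to_depth K Q (Suc n) =
     (let T = terms_to_depth K Q n in
      T \<union> (\<Union>f\<in>elts (symbols \<V>). Apply f ` {ts. set ts \<subseteq> T \<and> length ts = arity \<V> f}) \<union>
      Row_Lift ` T \<union> Col_Lift ` T \<union> Same_Base ` T)"

definition skolem_terms :: "'u algebra \<Rightarrow> 'u algebra \<Rightarrow> 'u skolem set" where
  "skolem_terms K Q = (\<Union>n. terms_to_depth K Q n)"

lemma small_skolem_terms: "small elts (skolem_terms K Q)"
  unfolding skolem_terms_def
proof (rule small_UNION[OF small_nat])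
  show "small elts (terms_to_depth K Q n)" for n
    by (induction n)
      (simp_all add: Let_def small_Un small_image smallI_elts small_UNION small_lists_length)
qed

lemma terms_to_depth_mono: "m \<le> n \<Longrightarrow> terms_to_depth K Q m \<subseteq> terms_to_depth K Q n"
  by (rule lift_Suc_mono_le[of "terms_to_depth K Q"]) (auto simp: Let_def)

lemma finite_terms_depth:
  assumes "set ts \<subseteq> skolem_terms K Q"
  shows "\<exists>n. set ts \<subseteq> terms_to_depth K Q n"
  using assms
proof (induction ts)
  case (Cons t ts)
  then obtain n m where "set ts \<subseteq> terms_to_depth K Q n" "t \<in> terms_to_depth K Q m"
    by (auto simp: skolem_terms_def)
  then have "set (t # ts) \<subseteq> terms_to_depth K Q (max n m)"
    using terms_to_depth_mono[of n "max n m" K Q] terms_to_depth_mono[of m "max n m" K Q] by auto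
  then show ?case by blast
qed simp

lemma skolem_terms_intros:
  "x \<in> U K \<Longrightarrow> From_K x \<in> skolem_terms K Q"
  "z \<in> U Q \<Longrightarrow> Over_Q z \<in> skolem_terms K Q"
  "t \<in> skolem_terms K Q \<Longrightarrow> Row_Lift t \<in> skolem_terms K Q"
  "t \<in> skolem_terms K Q \<Longrightarrow> Col_Lift t \<in> skolem_terms K Q"
  "t \<in> skolem_terms K Q \<Longrightarrow> Same_Base t \<in> skolem_terms K Q"
proof -
  show "x \<in> U K \<Longrightarrow> From_K x \<in> skolem_terms K Q" "z \<in> U Q \<Longrightarrow> Over_Q z \<in> skolem_terms K Q"
    unfolding skolem_terms_def by (rule UN_I[of 0]; simp)+
  assume "t \<in> skolem_terms K Q"
  then obtain n where "t \<in> terms_to_depth K Q n" by (auto simp: skolem_terms_def)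
  then have "{Row_Lift t, Col_Lift t, Same_Base t} \<subseteq> terms_to_depth K Q (Suc n)"
    by (simp add: Let_def)
  then show "Row_Lift t \<in> skolem_terms K Q" "Col_Lift t \<in> skolem_terms K Q"
      "Same_Base t \<in> skolem_terms K Q"
    unfolding skolem_terms_def by blast+
qed

lemma Apply_skolem_terms:
  assumes "f \<in> elts (symbols \<V>)" "length ts = arity \<V> f" "set ts \<subseteq> skolem_terms K Q"
  shows "Apply f ts \<in> skolem_terms K Q"
proof -
  obtain n where "set ts \<subseteq> terms_to_depth K Q n" using finite_terms_depth[OF assms(3)] by blast
  then have "Apply f ts \<in> terms_to_depth K Q (Suc n)" using assms(1,2) by (auto simp: Let_def)
  then show ?thesis unfolding skolem_terms_def by blast
qed


subsection \<open>Interpretation in a diagram\<close>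

definition row_lifts :: "('u algebra, 'u homomorphism) diagram \<Rightarrow> 'u \<Rightarrow> 'u set" where
  "row_lifts D y = {m \<in> U (Y D). row_qf D Two m = zero (node D Two Three) \<and>
     col_qf D Two m = col_qf D Two y}"

text \<open>
  Elements of the kernel of the middle row are their own lifting, and elements without a lifting are
  sent to zero, which is in that kernel.  So the elements fixed by \<open>row_lift\<close> are exactly those of
  the kernel, and membership in the kernel is expressed by an equation.
\<close>

definition row_lift :: "('u algebra, 'u homomorphism) diagram \<Rightarrow> 'u \<Rightarrow> 'u" where
  "row_lift D y = (if y \<in> row_lifts D y then y
     else if row_lifts D y \<noteq> {} then SOME m. m \<in> row_lifts D y else zero (Y D))"

definition section_out :: "('u algebra, 'u homomorphism) diagram \<Rightarrow> 'u \<Rightarrow> 'u" where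
  "section_out D z = (SOME y. y \<in> U (Y D) \<and> out D y = z)"

text \<open>
  Being over \<open>z\<close> is expressed by an equation between \<open>Same_Base t\<close> and \<open>Over_Q z\<close>, since distinct
  elements of \<open>Q\<close> have distinct chosen preimages.
\<close>

primrec interp :: "('u algebra, 'u homomorphism) diagram \<Rightarrow> 'u skolem \<Rightarrow> 'u" where
  "interp D (From_K x) = into D x"
| "interp D (Over_Q z) = section_out D z"
| "interp D (Apply f ts) = oper (Y D) f (map (interp D) ts)"
| "interp D (Row_Lift t) = row_lift D (interp D t)"
| "interp D (Col_Lift t) = row_lift (transpose D) (interp D t)"
| "interp D (Same_Base t) = section_out D (out D (interp D t))"

lemma section_out:
  assumes "D \<in> \<D> K Q" "z \<in> U Q"
  shows "section_out D z \<in> U (Y D)" "out D (section_out D z) = z"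
  using someI_ex[of "\<lambda>y. y \<in> U (Y D) \<and> out D y = z"] out_surj[OF assms]
  unfolding section_out_def by blast+

lemma Y_Alg: "D \<in> \<D> K Q \<Longrightarrow> Y D \<in> Alg"
  by (simp add: three_by_three_def)

lemma row_lift_in: "row_lifts D y \<noteq> {} \<Longrightarrow> row_lift D y \<in> row_lifts D y"
  by (simp add: row_lift_def some_in_eq)

lemma row_lift_kernel:
  assumes D: "D \<in> \<D> K Q"
  shows "row_lift D y \<in> U (Y D)" "row_qf D Two (row_lift D y) = zero (node D Two Three)"
proof -
  have "row_lift D y = zero (Y D)" if "row_lifts D y = {}"
    using that by (simp add: row_lift_def)
  then show "row_lift D y \<in> U (Y D)" "row_qf D Two (row_lift D y) = zero (node D Two Three)"
    using row_lift_in[of D y] zero_in[OF Y_Alg[OF D]] morph_zero[OF row_morph(2)[OF D, of Two]]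
    by (cases "row_lifts D y = {}"; simp add: row_lifts_def)+
qed

lemma row_lift_fixed:
  assumes D: "D \<in> \<D> K Q" and y: "y \<in> U (Y D)"
  shows "row_lift D y = y \<longleftrightarrow> row_qf D Two y = zero (node D Two Three)"
proof
  assume "row_lift D y = y"
  then show "row_qf D Two y = zero (node D Two Three)" using row_lift_kernel(2)[OF D, of y] by simp
next
  assume "row_qf D Two y = zero (node D Two Three)"
  then show "row_lift D y = y" using y by (simp add: row_lift_def row_lifts_def)
qed

lemma row_lift_col:
  assumes D: "D \<in> \<D> K Q" and y: "y \<in> U (Y D)" "out D y = zero Q"
  shows "col_qf D Two (row_lift D y) = col_qf D Two y"
proof -
  have "row_lifts D y \<noteq> {}" using out_zero_lift[OF D y] by (auto simp: row_lifts_def)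
  then show ?thesis using row_lift_in[of D y] by (simp add: row_lifts_def)
qed

lemma interp_in:
  assumes D: "D \<in> \<D> K Q"
  shows "t \<in> skolem_terms K Q \<Longrightarrow> interp D t \<in> U (Y D)"
proof -
  have "t \<in> terms_to_depth K Q n \<Longrightarrow> interp D t \<in> U (Y D)" for n
  proof (induction n arbitrary: t)
    case 0
    then show ?case using morph_in[OF morph_into[OF D]] section_out[OF D] by auto
  next
    case (Suc n)
    have "oper (Y D) f (map (interp D) ts) \<in> U (Y D)"
      if "f \<in> elts (symbols \<V>)" "set ts \<subseteq> terms_to_depth K Q n" "length ts = arity \<V> f" for f ts
      by (rule Alg_oper[OF Y_Alg[OF D]]) (use that Suc.IH in auto)
    then show ?case
      using Suc row_lift_kernel(1)[OF D] row_lift_kernel(1)[OF transpose_three_by_three[OF D]]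
        section_out(1)[OF D] morph_in[OF morph_out[OF D]]
      by (auto simp: Let_def)
  qed
  then show "t \<in> skolem_terms K Q \<Longrightarrow> interp D t \<in> U (Y D)"
    by (auto simp: skolem_terms_def)
qed

definition hull :: "('u algebra, 'u homomorphism) diagram \<Rightarrow> 'u set" where
  "hull D = interp D ` skolem_terms (node D One One) (node D Three Three)"

lemma hull_eq: "D \<in> \<D> K Q \<Longrightarrow> hull D = interp D ` skolem_terms K Q"
  by (simp add: hull_def diagram_corners)

lemma args_interp:
  assumes "(f, ys) \<in> args (interp D ` skolem_terms K Q)"
  obtains ts where "ys = map (interp D) ts" "set ts \<subseteq> skolem_terms K Q" "Apply f ts \<in> skolem_terms K Q"
proof -
  have "ys \<in> map (interp D) ` lists (skolem_terms K Q)"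
    using assms by (auto simp: lists_image[symmetric])
  then obtain ts where ts: "ys = map (interp D) ts" "set ts \<subseteq> skolem_terms K Q" by auto
  then have "Apply f ts \<in> skolem_terms K Q"
    using assms by (intro Apply_skolem_terms) auto
  with ts show ?thesis by (rule that)
qed

lemma spanning_hull:
  assumes D: "D \<in> \<D> K Q"
  shows "spanning D (hull D)"
proof -
  note D' = transpose_three_by_three[OF D]
  let ?T = "skolem_terms K Q"
  have "closed (Y D) (hull D)"
  proof (rule closedI)
    show "Y D \<in> Alg" by (rule Y_Alg[OF D])
    show "hull D \<subseteq> U (Y D)" using interp_in[OF D] by (auto simp: hull_eq[OF D])
    fix f ys assume "(f, ys) \<in> args (hull D)"
    then obtain ts where "ys = map (interp D) ts" "Apply f ts \<in> ?T"
      unfolding hull_eq[OF D] by (rule args_interp)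
    then show "oper (Y D) f ys \<in> hull D"
      unfolding hull_eq[OF D] by (intro image_eqI[of _ _ "Apply f ts"]) simp_all
  qed
  moreover have "into D x \<in> hull D" if "x \<in> U K" for x
    unfolding hull_eq[OF D]
    by (rule image_eqI[of _ _ "From_K x"]) (simp_all add: skolem_terms_intros that)
  moreover have "\<exists>y\<in>hull D. out D y = z" if "z \<in> U Q" for z
    unfolding hull_eq[OF D] using section_out[OF D that] skolem_terms_intros(2)[OF that, of K]
    by (metis image_eqI interp.simps(2))
  moreover have "\<exists>m\<in>hull D. row_qf D Two m = zero (node D Two Three) \<and> col_qf D Two m = col_qf D Two y"
    and "\<exists>n\<in>hull D. col_qf D Two n = zero (node D Three Two) \<and> row_qf D Two n = row_qf D Two y"
    if y: "y \<in> hull D" "out D y = zero Q" for y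
  proof -
    obtain t where t: "t \<in> ?T" "y = interp D t" using y(1) by (auto simp: hull_eq[OF D])
    have yY: "y \<in> U (Y D)" using interp_in[OF D t(1)] t(2) by simp
    have in_hull: "row_lift D y \<in> hull D" "row_lift (transpose D) y \<in> hull D"
      unfolding hull_eq[OF D] t(2)
      using image_eqI[of _ "interp D" "Row_Lift t"] image_eqI[of _ "interp D" "Col_Lift t"]
        skolem_terms_intros(3,4)[OF t(1)] by simp_all
    show "\<exists>m\<in>hull D. row_qf D Two m = zero (node D Two Three) \<and> col_qf D Two m = col_qf D Two y"
      using in_hull(1) row_lift_kernel(2)[OF D] row_lift_col[OF D yY y(2)] by blast
    have "row_qf D Two (row_lift (transpose D) y) = row_qf D Two y"
      using row_lift_col[OF D', of y] yY y(2) out_transpose[OF D yY] by simp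
    moreover have "col_qf D Two (row_lift (transpose D) y) = zero (node D Three Two)"
      using row_lift_kernel(2)[OF D', of y] by simp
    ultimately show
      "\<exists>n\<in>hull D. col_qf D Two n = zero (node D Three Two) \<and> row_qf D Two n = row_qf D Two y"
      using in_hull(2) by blast
  qed
  ultimately show ?thesis
    unfolding spanning_def diagram_corners[OF D] by blast
qed


section \<open>Double extensions form a small collection\<close>

definition equations :: "'u algebra \<Rightarrow> 'u algebra \<Rightarrow> ('u algebra, 'u homomorphism) diagram \<Rightarrow>
    ('u skolem \<times> 'u skolem) set" where
  "equations K Q D =
    {(s, t). s \<in> skolem_terms K Q \<and> t \<in> skolem_terms K Q \<and> interp D s = interp D t}"

text \<open>
  The homomorphism sends the value of a term in \<open>D\<close> to its value in \<open>E\<close>.  It respects \<open>K\<close> and the operations by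
  construction; the equations for \<open>Same_Base\<close>, \<open>Row_Lift\<close> and \<open>Col_Lift\<close> carry over
  the position over \<open>Q\<close> and membership in the two kernels.
\<close>

lemma same_equations_step:
  assumes D: "D \<in> \<D> K Q" and E: "E \<in> \<D> K Q" and eq: "equations K Q D = equations K Q E"
  shows "(restriction D (hull D), E) \<in> diagram_step \<C> K Q"
proof -
  let ?T = "skolem_terms K Q" and ?S = "hull D" and ?R = "restriction D (hull D)"
  note D' = transpose_three_by_three[OF D] and E' = transpose_three_by_three[OF E]
  have S: "spanning D ?S" by (rule spanning_hull[OF D])
  have R: "?R \<in> \<D> K Q" by (rule restriction_three_by_three[OF D S])
  have closed: "closed (Y D) ?S" using S by (simp add: spanning_def)
  have YR: "Y ?R = sub (Y D) ?S" by (simp add: part_def)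
  have UYR: "U (Y ?R) = ?S" unfolding YR by (rule U_sub_closed[OF closed])
  have transfer: "interp E s = interp E t" if "s \<in> ?T" "t \<in> ?T" "interp D s = interp D t" for s t
  proof -
    have "(s, t) \<in> equations K Q D" using that by (simp add: equations_def)
    then show ?thesis unfolding eq by (simp add: equations_def)
  qed
  define h where "h y = interp E (inv_into ?T (interp D) y)" for y
  have h: "h (interp D t) = interp E t" if "t \<in> ?T" for t
    unfolding h_def using that by (intro transfer inv_into_into f_inv_into_f) auto
  have S_cases: "\<exists>t\<in>?T. y = interp D t" if "y \<in> ?S" for y
    using that by (auto simp: hull_eq[OF D])
  have h_morph: "morph (Y ?R) (Y E) h"
  proof (rule morphI)
    show "Y ?R \<in> Alg" "Y E \<in> Alg" using Y_Alg[OF R] Y_Alg[OF E] .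
    show "h y \<in> U (Y E)" if "y \<in> U (Y ?R)" for y
      using that S_cases[of y] h interp_in[OF E] unfolding UYR by force
    fix f ys assume "(f, ys) \<in> args (U (Y ?R))"
    then have a: "(f, ys) \<in> args ?S" unfolding UYR .
    then obtain ts where ts: "ys = map (interp D) ts" "set ts \<subseteq> ?T" "Apply f ts \<in> ?T"
      unfolding hull_eq[OF D] by (rule args_interp)
    have "oper (Y ?R) f ys = interp D (Apply f ts)"
      unfolding YR oper_sub[OF a] using ts(1) by simp
    then have "h (oper (Y ?R) f ys) = oper (Y E) f (map (interp E) ts)"
      using h[OF ts(3)] by simp
    also have "map (interp E) ts = map h ys"
      using ts(1,2) h by auto
    finally show "h (oper (Y ?R) f ys) = oper (Y E) f (map h ys)" .
  qed
  have R_maps: "row_qf ?R Two y = row_qf D Two y" "col_qf ?R Two y = col_qf D Two y"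
    "out ?R y = out D y" if "y \<in> ?S" for y
  proof -
    have UT: "U (sub (Y D) (part D ?S Two Two)) = ?S" using UYR by simp
    have "closed (node D Three Two) (part D ?S Three Two)" by (rule closed_part[OF D S])
    then have U3: "U (sub (node D Three Two) (part D ?S Three Two)) = part D ?S Three Two" by simp
    show "row_qf ?R Two y = row_qf D Two y" and c: "col_qf ?R Two y = col_qf D Two y"
      using that UT by simp_all
    have "col_qf D Two y \<in> part D ?S Three Two" using that by (simp add: part_def)
    then show "out ?R y = out D y"
      unfolding out_def c using U3 by simp
  qed
  have R_into: "into ?R x = into D x" if x: "x \<in> U K" for x
  proof -
    have "x \<in> U (sub (node D One One) (part D ?S One One))"
      using x diagram_corners(1)[OF R] by simp
    moreover from this have "row_kf D One x \<in> U (sub (node D One Two) (part D ?S One Two))"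
      using morph_in[OF row_morph(1)[OF R, of One]] by fastforce
    ultimately show ?thesis by (simp add: into_def)
  qed
  have h_into: "h (into D x) = into E x" if "x \<in> U K" for x
    using h[OF skolem_terms_intros(1)[OF that]] by simp
  have h_out: "out E (h y) = out D y" if "y \<in> ?S" for y
  proof -
    obtain t where t: "t \<in> ?T" "y = interp D t" using S_cases[OF \<open>y \<in> ?S\<close>] by blast
    let ?z = "out D y"
    have z: "?z \<in> U Q" using morph_in[OF morph_out[OF D] interp_in[OF D t(1)]] t(2) by simp
    have tE: "interp E t \<in> U (Y E)" by (rule interp_in[OF E t(1)])
    have "interp E (Same_Base t) = interp E (Over_Q ?z)"
      by (rule transfer) (use t z in \<open>simp_all add: skolem_terms_intros\<close>)
    then have "section_out E (out E (interp E t)) = section_out E ?z" by simp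
    then have "out E (interp E t) = ?z"
      using section_out(2)[OF E z] section_out(2)[OF E morph_in[OF morph_out[OF E] tE]] by metis
    then show ?thesis using h[OF t(1)] t(2) by simp
  qed
  have h_row: "row_qf E Two (h y) = zero (node E Two Three)"
    if y: "y \<in> ?S" "row_qf D Two y = zero (node D Two Three)" for y
  proof -
    obtain t where t: "t \<in> ?T" "y = interp D t" using S_cases[OF y(1)] by blast
    have "interp E (Row_Lift t) = interp E t"
      by (rule transfer)
        (use t y(2) row_lift_fixed[OF D interp_in[OF D t(1)]] in \<open>simp_all add: skolem_terms_intros\<close>)
    then show ?thesis
      using row_lift_fixed[OF E interp_in[OF E t(1)]] h[OF t(1)] t(2) by simp
  qed
  have h_col: "col_qf E Two (h y) = zero (node E Three Two)"
    if y: "y \<in> ?S" "col_qf D Two y = zero (node D Three Two)" for y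
  proof -
    obtain t where t: "t \<in> ?T" "y = interp D t" using S_cases[OF y(1)] by blast
    have "interp E (Col_Lift t) = interp E t"
      by (rule transfer)
        (use t y(2) row_lift_fixed[OF D', of y] interp_in[OF D t(1)] in
          \<open>simp_all add: skolem_terms_intros\<close>)
    then show ?thesis
      using row_lift_fixed[OF E', of "interp E t"] interp_in[OF E t(1)] h[OF t(1)] t(2) by simp
  qed
  have R_zero: "zero (node ?R Two Three) = zero (node D Two Three)"
    "zero (node ?R Three Two) = zero (node D Three Two)"
    using closed_part[OF D S] by (simp_all add: zero_sub)
  show ?thesis
  proof (rule diagram_step_from_middle[OF R E h_morph])
    show "h (into ?R x) = into E x" if "x \<in> U K" for x
      unfolding R_into[OF that] by (rule h_into[OF that])
    fix y assume "y \<in> U (Y ?R)"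
    then have y: "y \<in> ?S" unfolding UYR .
    show "out E (h y) = out ?R y"
      unfolding R_maps[OF y] by (rule h_out[OF y])
    show "row_qf E Two (h y) = zero (node E Two Three)" if "row_qf ?R Two y = zero (node ?R Two Three)"
      using that unfolding R_maps[OF y] R_zero by (rule h_row[OF y])
    show "col_qf E Two (h y) = zero (node E Three Two)" if "col_qf ?R Two y = zero (node ?R Three Two)"
      using that unfolding R_maps[OF y] R_zero by (rule h_col[OF y])
  qed
qed

text \<open>
  The subdiagram of \<open>D\<close> maps to both: to \<open>E\<close> by hypothesis, and to \<open>D\<close> because \<open>D\<close> trivially satisfies the
  same equations as itself.
\<close>

lemma same_equations_zigzag:
  assumes D: "D \<in> \<D> K Q" and E: "E \<in> \<D> K Q" and eq: "equations K Q D = equations K Q E"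
  shows "(D, E) \<in> zigzag \<C> K Q"
proof -
  let ?s = "diagram_step \<C> K Q" and ?R = "restriction D (hull D)"
  have "(D, ?R) \<in> ?s \<union> ?s\<inverse>" using same_equations_step[OF D D refl] by blast
  moreover have "(?R, E) \<in> ?s \<union> ?s\<inverse>" using same_equations_step[OF D E eq] by blast
  ultimately have "(D, E) \<in> (?s \<union> ?s\<inverse>)\<^sup>*" by (meson r_into_rtrancl rtrancl_trans)
  then show ?thesis using D E by (simp add: zigzag_def)
qed

text \<open>
  A double extension is recovered from the equations that hold in any of its representatives.
\<close>

lemma small_two_Ext: "small elts (two_Ext \<C> Q K)"
proof -
  let ?T = "skolem_terms K Q"
  have "small elts (Pow (?T \<times> ?T))"
    by (intro small_Pow small_Times small_skolem_terms)
  then show ?thesis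
  proof (rule small_inj)
    let ?rep = "\<lambda>c. SOME D. D \<in> c"
    let ?s = "diagram_step \<C> K Q"
    have sym: "sym ((?s \<union> ?s\<inverse>)\<^sup>*)" by (rule sym_rtrancl) (auto simp: sym_def)
    have equiv: "equiv (\<D> K Q) (zigzag \<C> K Q)"
    proof (rule equivI)
      show "zigzag \<C> K Q \<subseteq> \<D> K Q \<times> \<D> K Q" by (auto simp: zigzag_def)
      show "refl_on (\<D> K Q) (zigzag \<C> K Q)" by (auto simp: zigzag_def refl_on_def)
      show "sym (zigzag \<C> K Q)" using sym by (auto simp: zigzag_def sym_def)
      show "trans (zigzag \<C> K Q)" by (auto simp: zigzag_def trans_def)
    qed
    have rep: "?rep c \<in> c" "?rep c \<in> \<D> K Q" if "c \<in> two_Ext \<C> Q K" for c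
    proof -
      have c: "c \<in> \<D> K Q // zigzag \<C> K Q" using that by (simp add: two_Ext_def)
      then have "c \<noteq> {}" using in_quotient_imp_non_empty[OF equiv] by blast
      then show "?rep c \<in> c" by (simp add: some_in_eq)
      then show "?rep c \<in> \<D> K Q" using in_quotient_imp_subset[OF equiv c] by blast
    qed
    show "inj_on (\<lambda>c. equations K Q (?rep c)) (two_Ext \<C> Q K)"
    proof (rule inj_onI)
      fix c d assume c: "c \<in> two_Ext \<C> Q K" and d: "d \<in> two_Ext \<C> Q K"
        and eq: "equations K Q (?rep c) = equations K Q (?rep d)"
      have "(?rep c, ?rep d) \<in> zigzag \<C> K Q"
        by (rule same_equations_zigzag[OF rep(2)[OF c] rep(2)[OF d] eq])
      then show "c = d"
        using quotient_eqI[OF equiv _ _ rep(1)[OF c] rep(1)[OF d]] c d by (simp add: two_Ext_def)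
    qed
    show "(\<lambda>c. equations K Q (?rep c)) ` two_Ext \<C> Q K \<subseteq> Pow (?T \<times> ?T)"
      by (auto simp: equations_def)
  qed
qed

end

theorem theorem6p1:
  fixes elts :: "'u \<Rightarrow> 'u set"
    and \<V> :: "'u presentation"
    and K Q :: "'u algebra"
  assumes "grothendieck_universe elts"
    and "variety_presentation elts \<V>"
    and "semi_abelian (variety elts \<V>)"
    and "K \<in> Obj (variety elts \<V>)"
    and "Q \<in> Obj (variety elts \<V>)"
  shows "small elts (two_Ext (variety elts \<V>) Q K)"
proof -
  interpret semi_abelian_variety elts \<V>
    using assms(1-3)
    by (simp add: semi_abelian_variety_def semi_abelian_variety_axioms_def
        variety_of_algebras_def variety_of_algebras_axioms_def)
  show ?thesis by (rule small_two_Ext)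
qed

end
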